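(* Let $\mathcal P$ be a grand preference on $\mathfrak H$ and let $\mathbf U$ be a compatible utility system for $\mathcal P$. Suppose that $\mathcal P$ satisfies the six axioms (weak order, continuity, dynamic consistency, terminal compatibility, compensated consumption monotonicity, weak separability) and that $\mathbf U$ satisfies certainty-equivalent richness. Then the canonical PA-state system $\mathfrak X^*$ admits a PA recursive structure $\mathcal V^*$ such that $(\mathfrak X^*,\mathcal V^* )$ factorizes $\mathbf U$. Consequently, $(\mathfrak X^*,\mathcal V^* )$ represents $\mathcal P$.
   Context: **Primitives.** For an integer $n\ge 0$, $[n]=\{0,1,\dots,n\}$. $T\ge 1$ is an integer horizon. $\mathcal S$ is a finite nonempty set (discrete topology); $\mathcal S_0=\{\bar s_0\}$ is a singleton, $\mathcal S_t=\mathcal S$ for $1\le t\le T$, $\mathcal S_{T+1}=\{\star\}$. $\mathcal C=[0,\bar c]\subset\mathbb R_{\ge 0}$ is a compact interval. Histories: $\mathcal H_0=\{\bar s_0\}$, $\mathcal H_t=\mathcal H_{t-1}\times\mathcal C\times\mathcal S_t$ for $1\le t\le T$, $\mathcal H_{T+1}=\mathcal H_T\times\mathcal C$, with product topologies (compact metrizable). Extension maps $\iota_t:\mathcal H_t\times\mathcal C\times\mathcal S_{t+1}\to\mathcal H_{t+1}$: $\iota_t(h_t,c,s)=(h_t,c,s)$ for $t\in[T-1]$, $\iota_T(h_T,c,\star)=(h_T,c)$. Physical-state projections $\sigma^s_t:\mathcal H_t\to\mathcal S_t$: $\sigma_t^s(h_t)$ is the last state $s_t$ of $h_t$ for $t\in[T]$,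 and $\sigma^s_{T+1}\equiv\star$. $\mathfrak H=(\{\mathcal H_t\},\{\sigma^s_t\},\{\iota_t\})$. Plans: $\mathcal F_{T+1}=\{\emptyset\}$ and $\mathcal F_t=\mathcal C\times(\mathcal F_{t+1})^{\mathcal S}$ for $t\in[T]$ (product topology); $\mathcal F_T$ is identified with $\mathcal C$. For $t\in[T-1]$ a plan is written $f=(c,f_+)$ with $c\in\mathcal C$, $f_+:\mathcal S\to\mathcal F_{t+1}$. $\mathcal D_t=\mathcal H_t\times\mathcal F_t$. **Preferences.** A grand preference on $\mathfrak H$ is $\mathcal P=(\{\succeq_{(t)}\}_{t=0}^T,V_{T+1})$ with $\succeq_{(t)}$ a binary relation on $\mathcal D_t$ and $V_{T+1}:\mathcal H_{T+1}\to\mathbb R$ continuous; $\succ_{(t)},\sim_{(t)}$ denote its strict part and indifference. Conditional preference: $f\succeq_{h_t}g$ iff $(h_t,f)\succeq_{(t)}(h_t,g)$. A utility system is $\mathbf U=\{U_t\}_{t=0}^{T+1}$ with $U_t:\mathcal H_t\times\mathcal F_t\to\mathbb R$ ($t\in[T]$) and $U_{T+1}:\mathcal H_{T+1}\to\mathbb R$ continuous. It is compatible with $\mathcal P$ if $U_{T+1}=V_{T+1}$; $U_T(h_T,c)=U_{T+1}(\iota_T(h_T,c,\star))$ for all $h_T,c$; and for all $t\in[T]$, $U_t(h_t,f)\ge U_t(h_t',g)\iff(h_t,f)\succeq_{(t)}(h_t',g)$. **Axioms.** (1) Weak order: each $\succeq_{(t)}$, $t\in[T]$, is complete and transitive. (2)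 Continuity: for each $t\in[T]$ and $(h_t,f)\in\mathcal D_t$, the sets $\{(h_t',g):(h_t',g)\succeq_{(t)}(h_t,f)\}$ and $\{(h_t',g):(h_t,f)\succeq_{(t)}(h_t',g)\}$ are closed in $\mathcal D_t$. (3) Dynamic consistency: for $t\in[T-1]$, $h_t$, $c$, and $f=(c,f_+),g=(c,g_+)\in\mathcal F_t$, if $(\iota_t(h_t,c,s),f_+(s))\succeq_{(t+1)}(\iota_t(h_t,c,s),g_+(s))$ for all $s\in\mathcal S$, then $(h_t,f)\succeq_{(t)}(h_t,g)$. (4) Terminal compatibility: $(h_T,c)\succeq_{(T)}(h_T',c')$ iff $V_{T+1}((h_T,c))\ge V_{T+1}((h_T',c'))$. (5) Compensated consumption monotonicity: for $t\in[T-1]$, $h_t$, $c>c'$ in $\mathcal C$, $f_+,g_+\in(\mathcal F_{t+1})^{\mathcal S}$, if $(\iota_t(h_t,c,s),f_+(s))\sim_{(t+1)}(\iota_t(h_t,c',s),g_+(s))$ for all $s\in\mathcal S$, then $(h_t,(c,f_+))\succ_{(t)}(h_t,(c',g_+))$. (6) Weak separability: for $t\in[T-1]$, $h_t$, $c,c'\in\mathcal C$, $f_+,g_+,f_+',g_+'\in(\mathcal F_{t+1})^{\mathcal S}$, if $(\iota_t(h_t,c,s),f_+(s))\sim_{(t+1)}(\iota_t(h_t,c',s),f'_+(s))$ and $(\iota_t(h_t,c,s),g_+(s))\sim_{(t+1)}(\iota_t(h_t,c',s),g'_+(s))$ for all $s\in\mathcal S$, then $(h_t,(c,f_+))\succeq_{(t)}(h_t,(c,g_+))\iff(h_t,(c',f'_+))\succeq_{(t)}(h_t,(c',g'_+))$.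 **Certainty-equivalent richness of $\mathbf U$.** Let $\mathcal L=\mathbb R^{\mathcal S}$ with sup norm and pointwise order; for $v\in\mathbb R$, $\mathbf v\in\mathcal L$ is the constant vector. For $t\in[T-1]$ and $f=(c,f_+)\in\mathcal F_t$ let $[\tilde u_{t+1}(h_t,f)](s)=U_{t+1}(\iota_t(h_t,c,s),f_+(s))$, $s\in\mathcal S$. Let $\Lambda_t^{\mathbf U}(h_t,c)=\{\tilde u_{t+1}(h_t,(c,f_+)):f_+\in(\mathcal F_{t+1})^{\mathcal S}\}$, $\Lambda_t^{\mathbf U}(h_t)=\bigcup_{c\in\mathcal C}\Lambda_t^{\mathbf U}(h_t,c)$, $D_t^M=\{(h_t,\tilde u):\tilde u\in\Lambda_t^{\mathbf U}(h_t)\}$. Richness: for every $t\in[T-1]$ there is a jointly continuous $M_t^0:D_t^M\to\mathbb R$ such that for each $h_t$: (i) for $f=(c,f_+),g=(c,g_+)\in\mathcal F_t$ with the same $c$, $f\succeq_{h_t}g$ iff $M_t^0(h_t,\tilde u_{t+1}(h_t,f))\ge M_t^0(h_t,\tilde u_{t+1}(h_t,g))$, and $M_t^0(h_t,\mathbf v)=v$ whenever $\mathbf v\in\Lambda_t^{\mathbf U}(h_t)$; (ii) $\min_s\tilde u(s)\le M_t^0(h_t,\tilde u)\le\max_s\tilde u(s)$ for $\tilde u\in\Lambda_t^{\mathbf U}(h_t)$; (iii) for every $f=(c,f_+)\in\mathcal F_t$, with $v=M_t^0(h_t,\tilde u_{t+1}(h_t,f))$, there is $(c,g_+)\in\mathcal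 F_t$ with $\tilde u_{t+1}(h_t,(c,g_+))=\mathbf v$; (iv) if $\tilde u\le\tilde v$ in $\Lambda_t^{\mathbf U}(h_t)$ then $M_t^0(h_t,\tilde u)\le M_t^0(h_t,\tilde v)$. **PA-state systems.** A PA-state system is $\mathfrak X=(\{\mathcal X_t\}_{t=0}^{T+1},\{\varsigma_t\}_{t=0}^{T+1},\{\Gamma_t\}_{t=0}^{T})$ with $\mathcal X_t$ nonempty compact metrizable, $\varsigma_t:\mathcal X_t\to\mathcal S_t$ continuous, and $\Gamma_t:\mathcal X_t\times\mathcal C\times\mathcal S_{t+1}\to\mathcal X_{t+1}$ continuous with $\varsigma_{t+1}(\Gamma_t(x,c,s'))=s'$. A PA recursive structure on $\mathfrak X$ is $\mathcal V^*=(\{W_t^*\}_{t=0}^{T-1},\{M_t^*\}_{t=0}^{T-1},V_{T+1}^* )$ where $W_t^*:\mathcal X_t\times\mathcal C\times\mathbb R\to\mathbb R$ is jointly continuous and nondecreasing in its last argument; $M_t^*:\mathcal X_t\times\mathcal L\to\mathbb R$ is jointly continuous, monotone in $\tilde u\in\mathcal L$, and $M_t^*(x,\mathbf v)=v$ for all $x$, $v\in\mathbb R$; $V_{T+1}^*:\mathcal X_{T+1}\to\mathbb R$ is continuous. $(\mathfrak X,\mathcal V^* )$ generates $\{U_t^*\}$: $U_{T+1}^*=V_{T+1}^*$, $U_T^*(x_T,c)=U_{T+1}^*(\Gamma_T(x_T,c,\star))$, and for $t\in[T-1]$, $f=(c,f_+)$, $U_t^*(x_t,f)=W_t^*(x_t,c,M_t^*(x_t,\tilde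 u^*_{t+1}(x_t,f)))$ with $[\tilde u^*_{t+1}(x_t,f)](s)=U_{t+1}^*(\Gamma_t(x_t,c,s),f_+(s))$. **Factorization.** $(\mathfrak X,\mathcal V^* )$ factorizes $\mathbf U$ if there are continuous summary maps $\sigma_t:\mathcal H_t\to\mathcal X_t$ with $\varsigma_t\circ\sigma_t=\sigma_t^s$ ($t\in[T+1]$) such that $U_{T+1}=U_{T+1}^*\circ\sigma_{T+1}$, $U_t(h_t,f)=U_t^*(\sigma_t(h_t),f)$ for all $h_t,f$, $t\in[T]$, and $\sigma_{t+1}(\iota_t(h_t,c,s))=\Gamma_t(\sigma_t(h_t),c,s)$ for all $h_t,c,s\in\mathcal S_{t+1}$, $t\in[T]$. If it factorizes a compatible utility system for $\mathcal P$, it is said to represent $\mathcal P$. **Canonical PA-state system.** Define relations by backward recursion: $h_{T+1}\odot_{T+1}h'_{T+1}$ iff $U_{T+1}(h_{T+1})=U_{T+1}(h_{T+1}')$; for $t\in[T]$, $h_t\odot_th_t'$ iff (i) $\sigma_t^s(h_t)=\sigma_t^s(h'_t)$, (ii) $(h_t,f)\sim_{(t)}(h_t',f)$ for all $f\in\mathcal F_t$, and (iii) $\iota_t(h_t,c,s)\odot_{t+1}\iota_t(h_t',c,s)$ for all $c\in\mathcal C$, $s\in\mathcal S_{t+1}$. These are equivalence relations. $\mathfrak X^*$ consists of $\mathcal X_t=\mathcal H_t/\odot_t$ (quotient topology, canonical projection $\sigma_t$), $\varsigma_t$ determined by $\varsigma_t\circ\sigma_t=\sigma_t^s$, and $\Gamma_t$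 determined by $\Gamma_t(\sigma_t(h_t),c,s')=\sigma_{t+1}(\iota_t(h_t,c,s'))$; these are well defined and form a PA-state system. *)

theory Defs
  imports "HOL-Analysis.Analysis"
begin

text \<open>
  The finite nonempty state set is a type \<open>'s\<close> of class \<open>finite\<close>; \<open>T\<close> is the horizon and
  consumption lies in the interval from \<open>0\<close> to \<open>cbar\<close>.  Families of spaces indexed by time are
  families of abstract topologies on one carrier type: the space at time \<open>t\<close> is the \<open>topspace\<close>
  of the \<open>t\<close>-th topology, and every condition is relativised to it.
\<close>

datatype 's pstate = Init | Phys 's | Star

definition states :: "nat \<Rightarrow> nat \<Rightarrow> 's pstate set" where
  "states T t = (if t = 0 then {Init} else if t \<le> T then range Phys else {Star})"

abbreviation C_top :: "real \<Rightarrow> real topology" where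
  "C_top cbar \<equiv> top_of_set {0..cbar}"

datatype 's hist =
    HInit
  | HStep (h_prev: "'s hist") (h_con: real) (h_st: "'s pstate")
  | HFin (h_prev: "'s hist") (h_con: real)

text \<open>
  Pulling back along the (injective) destructor makes the constructor a homeomorphism from the
  product, so that up to the constructor names the spaces are \<open>H\<^sub>t \<times> C \<times> S\<^sub>t\<^sub>+\<^sub>1\<close> for \<open>t < T\<close> and
  \<open>H\<^sub>T \<times> C\<close> at the end.  Only times up to \<open>Suc T\<close> are meaningful.
\<close>

primrec hist_top :: "nat \<Rightarrow> real \<Rightarrow> nat \<Rightarrow> 's hist topology" where
  "hist_top T cbar 0 = discrete_topology {HInit}"
| "hist_top T cbar (Suc t) =
     (if t < T
      then pullback_topology {HStep h c s |h c s. True} (\<lambda>h. (h_prev h, h_con h, h_st h))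
             (prod_topology (hist_top T cbar t)
               (prod_topology (C_top cbar) (discrete_topology (states T (Suc t)))))
      else pullback_topology {HFin h c |h c. True} (\<lambda>h. (h_prev h, h_con h))
             (prod_topology (hist_top T cbar t) (C_top cbar)))"

definition hists :: "nat \<Rightarrow> real \<Rightarrow> nat \<Rightarrow> 's hist set" where
  "hists T cbar t = topspace (hist_top T cbar t)"

definition iota :: "nat \<Rightarrow> nat \<Rightarrow> 's hist \<Rightarrow> real \<Rightarrow> 's pstate \<Rightarrow> 's hist" where
  "iota T t h c s = (if t < T then HStep h c s else HFin h c)"

fun phys_state :: "'s hist \<Rightarrow> 's pstate" where
  "phys_state HInit = Init"
| "phys_state (HStep h c s) = s"
| "phys_state (HFin h c) = Star"

datatype 's plan = PEnd | Plan (p_con: real) (p_cont: "'s \<Rightarrow> 's plan")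

text \<open>The index of \<open>plan_top_aux\<close> is the number of remaining stages.\<close>

primrec plan_top_aux :: "real \<Rightarrow> nat \<Rightarrow> 's plan topology" where
  "plan_top_aux cbar 0 = discrete_topology {PEnd}"
| "plan_top_aux cbar (Suc n) =
     pullback_topology {Plan c k |c k. True} (\<lambda>f. (p_con f, p_cont f))
       (prod_topology (C_top cbar) (product_topology (\<lambda>_. plan_top_aux cbar n) UNIV))"

definition plan_top :: "nat \<Rightarrow> real \<Rightarrow> nat \<Rightarrow> 's plan topology" where
  "plan_top T cbar t = plan_top_aux cbar (Suc T - t)"

definition plans :: "nat \<Rightarrow> real \<Rightarrow> nat \<Rightarrow> 's plan set" where
  "plans T cbar t = topspace (plan_top T cbar t)"

text \<open>The set of maps from states to plans of time \<open>t\<close>.\<close>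

definition conts :: "nat \<Rightarrow> real \<Rightarrow> nat \<Rightarrow> ('s \<Rightarrow> 's plan) set" where
  "conts T cbar t = {k. \<forall>s. k s \<in> plans T cbar t}"

text \<open>The identification of terminal-date plans with consumption levels.\<close>

definition term_plan :: "real \<Rightarrow> 's plan" where
  "term_plan c = Plan c (\<lambda>_. PEnd)"

definition dec_top :: "nat \<Rightarrow> real \<Rightarrow> nat \<Rightarrow> ('s hist \<times> 's plan) topology" where
  "dec_top T cbar t = prod_topology (hist_top T cbar t) (plan_top T cbar t)"

definition decs :: "nat \<Rightarrow> real \<Rightarrow> nat \<Rightarrow> ('s hist \<times> 's plan) set" where
  "decs T cbar t = hists T cbar t \<times> plans T cbar t"

record 's grand_pref =
  pref :: "nat \<Rightarrow> 's hist \<times> 's plan \<Rightarrow> 's hist \<times> 's plan \<Rightarrow> bool"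
  termval :: "'s hist \<Rightarrow> real"

definition spref :: "'s grand_pref \<Rightarrow> nat \<Rightarrow> 's hist \<times> 's plan \<Rightarrow> 's hist \<times> 's plan \<Rightarrow> bool" where
  "spref P t a b \<longleftrightarrow> pref P t a b \<and> \<not> pref P t b a"

definition indiff :: "'s grand_pref \<Rightarrow> nat \<Rightarrow> 's hist \<times> 's plan \<Rightarrow> 's hist \<times> 's plan \<Rightarrow> bool" where
  "indiff P t a b \<longleftrightarrow> pref P t a b \<and> pref P t b a"

definition cond_pref :: "'s grand_pref \<Rightarrow> nat \<Rightarrow> 's hist \<Rightarrow> 's plan \<Rightarrow> 's plan \<Rightarrow> bool" where
  "cond_pref P t h f g \<longleftrightarrow> pref P t (h, f) (h, g)"

definition grand_preference :: "nat \<Rightarrow> real \<Rightarrow> 's grand_pref \<Rightarrow> bool" where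
  "grand_preference T cbar P \<longleftrightarrow> continuous_map (hist_top T cbar (Suc T)) euclideanreal (termval P)"

record 's util_sys =
  util :: "nat \<Rightarrow> 's hist \<Rightarrow> 's plan \<Rightarrow> real"
  uterm :: "'s hist \<Rightarrow> real"

definition utility_system :: "nat \<Rightarrow> real \<Rightarrow> 's util_sys \<Rightarrow> bool" where
  "utility_system T cbar U \<longleftrightarrow>
     (\<forall>t\<le>T. continuous_map (dec_top T cbar t) euclideanreal (\<lambda>(h, f). util U t h f)) \<and>
     continuous_map (hist_top T cbar (Suc T)) euclideanreal (uterm U)"

definition compatible :: "nat \<Rightarrow> real \<Rightarrow> 's grand_pref \<Rightarrow> 's util_sys \<Rightarrow> bool" where
  "compatible T cbar P U \<longleftrightarrow>
     (\<forall>h\<in>hists T cbar (Suc T). uterm U h = termval P h) \<and>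
     (\<forall>h\<in>hists T cbar T. \<forall>c\<in>{0..cbar}.
        util U T h (term_plan c) = uterm U (iota T T h c Star)) \<and>
     (\<forall>t\<le>T. \<forall>h\<in>hists T cbar t. \<forall>h'\<in>hists T cbar t.
        \<forall>f\<in>plans T cbar t. \<forall>g\<in>plans T cbar t.
        util U t h f \<ge> util U t h' g \<longleftrightarrow> pref P t (h, f) (h', g))"

definition weak_order :: "nat \<Rightarrow> real \<Rightarrow> 's grand_pref \<Rightarrow> bool" where
  "weak_order T cbar P \<longleftrightarrow>
     (\<forall>t\<le>T.
        (\<forall>a\<in>decs T cbar t. \<forall>b\<in>decs T cbar t. pref P t a b \<or> pref P t b a) \<and>
        (\<forall>a\<in>decs T cbar t. \<forall>b\<in>decs T cbar t. \<forall>d\<in>decs T cbar t.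
           pref P t a b \<longrightarrow> pref P t b d \<longrightarrow> pref P t a d))"

definition pref_continuity :: "nat \<Rightarrow> real \<Rightarrow> 's grand_pref \<Rightarrow> bool" where
  "pref_continuity T cbar P \<longleftrightarrow>
     (\<forall>t\<le>T. \<forall>a\<in>decs T cbar t.
        closedin (dec_top T cbar t) {b \<in> decs T cbar t. pref P t b a} \<and>
        closedin (dec_top T cbar t) {b \<in> decs T cbar t. pref P t a b})"

definition dynamic_consistency :: "nat \<Rightarrow> real \<Rightarrow> 's grand_pref \<Rightarrow> bool" where
  "dynamic_consistency T cbar P \<longleftrightarrow>
     (\<forall>t<T. \<forall>h\<in>hists T cbar t. \<forall>c\<in>{0..cbar}.
        \<forall>fp\<in>conts T cbar (Suc t). \<forall>gp\<in>conts T cbar (Suc t).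
        (\<forall>s. pref P (Suc t) (iota T t h c (Phys s), fp s) (iota T t h c (Phys s), gp s)) \<longrightarrow>
        pref P t (h, Plan c fp) (h, Plan c gp))"

definition terminal_compatibility :: "nat \<Rightarrow> real \<Rightarrow> 's grand_pref \<Rightarrow> bool" where
  "terminal_compatibility T cbar P \<longleftrightarrow>
     (\<forall>h\<in>hists T cbar T. \<forall>h'\<in>hists T cbar T. \<forall>c\<in>{0..cbar}. \<forall>c'\<in>{0..cbar}.
        pref P T (h, term_plan c) (h', term_plan c') \<longleftrightarrow>
        termval P (HFin h c) \<ge> termval P (HFin h' c'))"

definition compensated_monotonicity :: "nat \<Rightarrow> real \<Rightarrow> 's grand_pref \<Rightarrow> bool" where
  "compensated_monotonicity T cbar P \<longleftrightarrow>
     (\<forall>t<T. \<forall>h\<in>hists T cbar t. \<forall>c\<in>{0..cbar}. \<forall>c'\<in>{0..cbar}.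
        \<forall>fp\<in>conts T cbar (Suc t). \<forall>gp\<in>conts T cbar (Suc t).
        c > c' \<longrightarrow>
        (\<forall>s. indiff P (Suc t) (iota T t h c (Phys s), fp s) (iota T t h c' (Phys s), gp s)) \<longrightarrow>
        spref P t (h, Plan c fp) (h, Plan c' gp))"

definition weak_separability :: "nat \<Rightarrow> real \<Rightarrow> 's grand_pref \<Rightarrow> bool" where
  "weak_separability T cbar P \<longleftrightarrow>
     (\<forall>t<T. \<forall>h\<in>hists T cbar t. \<forall>c\<in>{0..cbar}. \<forall>c'\<in>{0..cbar}.
        \<forall>fp\<in>conts T cbar (Suc t). \<forall>gp\<in>conts T cbar (Suc t).
        \<forall>fp'\<in>conts T cbar (Suc t). \<forall>gp'\<in>conts T cbar (Suc t).
        (\<forall>s. indiff P (Suc t) (iota T t h c (Phys s), fp s) (iota T t h c' (Phys s), fp' s)) \<longrightarrow>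
        (\<forall>s. indiff P (Suc t) (iota T t h c (Phys s), gp s) (iota T t h c' (Phys s), gp' s)) \<longrightarrow>
        (pref P t (h, Plan c fp) (h, Plan c gp) \<longleftrightarrow> pref P t (h, Plan c' fp') (h, Plan c' gp')))"

definition tilde_u :: "nat \<Rightarrow> 's util_sys \<Rightarrow> nat \<Rightarrow> 's hist \<Rightarrow> 's plan \<Rightarrow> 's \<Rightarrow> real" where
  "tilde_u T U t h f = (\<lambda>s. util U (Suc t) (iota T t h (p_con f) (Phys s)) (p_cont f s))"

definition Lambda_at :: "nat \<Rightarrow> real \<Rightarrow> 's util_sys \<Rightarrow> nat \<Rightarrow> 's hist \<Rightarrow> real \<Rightarrow> ('s \<Rightarrow> real) set" where
  "Lambda_at T cbar U t h c = {tilde_u T U t h (Plan c fp) |fp. fp \<in> conts T cbar (Suc t)}"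

definition Lambda :: "nat \<Rightarrow> real \<Rightarrow> 's util_sys \<Rightarrow> nat \<Rightarrow> 's hist \<Rightarrow> ('s \<Rightarrow> real) set" where
  "Lambda T cbar U t h = (\<Union>c\<in>{0..cbar}. Lambda_at T cbar U t h c)"

definition DM :: "nat \<Rightarrow> real \<Rightarrow> 's util_sys \<Rightarrow> nat \<Rightarrow> ('s hist \<times> ('s \<Rightarrow> real)) set" where
  "DM T cbar U t = {(h, u). h \<in> hists T cbar t \<and> u \<in> Lambda T cbar U t h}"

text \<open>
  For finite \<open>'s\<close> the product topology \<open>euclidean\<close> on \<open>'s \<Rightarrow> real\<close> is the sup-norm topology, and
  the order on functions is the pointwise one.
\<close>

definition ce_richness :: "nat \<Rightarrow> real \<Rightarrow> ('s::finite) grand_pref \<Rightarrow> 's util_sys \<Rightarrow> bool" where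
  "ce_richness T cbar P U \<longleftrightarrow>
     (\<forall>t<T. \<exists>M0 :: 's hist \<Rightarrow> ('s \<Rightarrow> real) \<Rightarrow> real.
        continuous_map (subtopology (prod_topology (hist_top T cbar t) euclidean) (DM T cbar U t))
          euclideanreal (\<lambda>(h, u). M0 h u) \<and>
        (\<forall>h\<in>hists T cbar t.
           (\<forall>c\<in>{0..cbar}. \<forall>fp\<in>conts T cbar (Suc t). \<forall>gp\<in>conts T cbar (Suc t).
              cond_pref P t h (Plan c fp) (Plan c gp) \<longleftrightarrow>
              M0 h (tilde_u T U t h (Plan c fp)) \<ge> M0 h (tilde_u T U t h (Plan c gp))) \<and>
           (\<forall>v. (\<lambda>_. v) \<in> Lambda T cbar U t h \<longrightarrow> M0 h (\<lambda>_. v) = v) \<and>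
           (\<forall>u\<in>Lambda T cbar U t h. Min (range u) \<le> M0 h u \<and> M0 h u \<le> Max (range u)) \<and>
           (\<forall>c\<in>{0..cbar}. \<forall>fp\<in>conts T cbar (Suc t). \<exists>gp\<in>conts T cbar (Suc t).
              tilde_u T U t h (Plan c gp) = (\<lambda>_. M0 h (tilde_u T U t h (Plan c fp)))) \<and>
           (\<forall>u\<in>Lambda T cbar U t h. \<forall>v\<in>Lambda T cbar U t h. u \<le> v \<longrightarrow> M0 h u \<le> M0 h v)))"

record ('x, 's) pa_sys =
  pa_top :: "nat \<Rightarrow> 'x topology"
  pa_st :: "nat \<Rightarrow> 'x \<Rightarrow> 's pstate"
  pa_step :: "nat \<Rightarrow> 'x \<Rightarrow> real \<Rightarrow> 's pstate \<Rightarrow> 'x"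

definition pa_state_system :: "nat \<Rightarrow> real \<Rightarrow> ('x, 's) pa_sys \<Rightarrow> bool" where
  "pa_state_system T cbar X \<longleftrightarrow>
     (\<forall>t\<le>Suc T. topspace (pa_top X t) \<noteq> {} \<and> compact_space (pa_top X t) \<and>
        metrizable_space (pa_top X t) \<and>
        continuous_map (pa_top X t) (discrete_topology (states T t)) (pa_st X t)) \<and>
     (\<forall>t\<le>T.
        continuous_map
          (prod_topology (pa_top X t)
            (prod_topology (C_top cbar) (discrete_topology (states T (Suc t)))))
          (pa_top X (Suc t)) (\<lambda>(x, c, s). pa_step X t x c s) \<and>
        (\<forall>x\<in>topspace (pa_top X t). \<forall>c\<in>{0..cbar}. \<forall>s\<in>states T (Suc t).
           pa_st X (Suc t) (pa_step X t x c s) = s))"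

record ('x, 's) pa_rec =
  pa_W :: "nat \<Rightarrow> 'x \<Rightarrow> real \<Rightarrow> real \<Rightarrow> real"
  pa_M :: "nat \<Rightarrow> 'x \<Rightarrow> ('s \<Rightarrow> real) \<Rightarrow> real"
  pa_V :: "'x \<Rightarrow> real"

definition pa_recursive_structure ::
  "nat \<Rightarrow> real \<Rightarrow> ('x, 's::finite) pa_sys \<Rightarrow> ('x, 's) pa_rec \<Rightarrow> bool" where
  "pa_recursive_structure T cbar X V \<longleftrightarrow>
     pa_state_system T cbar X \<and>
     (\<forall>t<T.
        continuous_map (prod_topology (pa_top X t) (prod_topology (C_top cbar) euclideanreal))
          euclideanreal (\<lambda>(x, c, v). pa_W V t x c v) \<and>
        (\<forall>x\<in>topspace (pa_top X t). \<forall>c\<in>{0..cbar}. mono (pa_W V t x c)) \<and>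
        continuous_map (prod_topology (pa_top X t) euclidean) euclideanreal
          (\<lambda>(x, u). pa_M V t x u) \<and>
        (\<forall>x\<in>topspace (pa_top X t). mono (pa_M V t x) \<and> (\<forall>v. pa_M V t x (\<lambda>_. v) = v))) \<and>
     continuous_map (pa_top X (Suc T)) euclideanreal (pa_V V)"

text \<open>
  The recursion is on the plan, whose depth is \<open>Suc T - t\<close> at time \<open>t\<close>: the empty plan
  corresponds to time \<open>Suc T\<close>, and \<open>Plan c fp\<close> at time \<open>T\<close> to the terminal plan \<open>c\<close>.
\<close>

primrec gen_util :: "nat \<Rightarrow> ('x, 's) pa_sys \<Rightarrow> ('x, 's) pa_rec \<Rightarrow> nat \<Rightarrow> 'x \<Rightarrow> 's plan \<Rightarrow> real" where
  "gen_util T X V t x PEnd = pa_V V x"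
| "gen_util T X V t x (Plan c fp) =
     (if t < T
      then pa_W V t x c (pa_M V t x (\<lambda>s. gen_util T X V (Suc t) (pa_step X t x c (Phys s)) (fp s)))
      else pa_V V (pa_step X t x c Star))"

definition factorizes ::
  "nat \<Rightarrow> real \<Rightarrow> ('x, 's::finite) pa_sys \<Rightarrow> ('x, 's) pa_rec \<Rightarrow> 's util_sys \<Rightarrow> bool" where
  "factorizes T cbar X V U \<longleftrightarrow>
     (\<exists>\<sigma> :: nat \<Rightarrow> 's hist \<Rightarrow> 'x.
        (\<forall>t\<le>Suc T. continuous_map (hist_top T cbar t) (pa_top X t) (\<sigma> t) \<and>
           (\<forall>h\<in>hists T cbar t. pa_st X t (\<sigma> t h) = phys_state h)) \<and>
        (\<forall>h\<in>hists T cbar (Suc T). uterm U h = gen_util T X V (Suc T) (\<sigma> (Suc T) h) PEnd) \<and>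
        (\<forall>t\<le>T. \<forall>h\<in>hists T cbar t. \<forall>f\<in>plans T cbar t.
           util U t h f = gen_util T X V t (\<sigma> t h) f) \<and>
        (\<forall>t\<le>T. \<forall>h\<in>hists T cbar t. \<forall>c\<in>{0..cbar}. \<forall>s\<in>states T (Suc t).
           \<sigma> (Suc t) (iota T t h c s) = pa_step X t (\<sigma> t h) c s))"

definition represents ::
  "nat \<Rightarrow> real \<Rightarrow> ('x, 's::finite) pa_sys \<Rightarrow> ('x, 's) pa_rec \<Rightarrow> 's grand_pref \<Rightarrow> bool" where
  "represents T cbar X V P \<longleftrightarrow>
     (\<exists>U. utility_system T cbar U \<and> compatible T cbar P U \<and> factorizes T cbar X V U)"

function odot ::
  "nat \<Rightarrow> real \<Rightarrow> 's grand_pref \<Rightarrow> 's util_sys \<Rightarrow> nat \<Rightarrow> 's hist \<Rightarrow> 's hist \<Rightarrow> bool" where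
  "odot T cbar P U t h h' =
     (if T < t then uterm U h = uterm U h'
      else phys_state h = phys_state h' \<and>
           (\<forall>f\<in>plans T cbar t. indiff P t (h, f) (h', f)) \<and>
           (\<forall>c\<in>{0..cbar}. \<forall>s\<in>states T (Suc t).
              odot T cbar P U (Suc t) (iota T t h c s) (iota T t h' c s)))"
  by pat_completeness auto
termination
  by (relation "Wellfounded.measure (\<lambda>(T, cbar, P, U, t, h, h'). Suc T - t)") auto

declare odot.simps [simp del]

definition canon_proj ::
  "nat \<Rightarrow> real \<Rightarrow> 's grand_pref \<Rightarrow> 's util_sys \<Rightarrow> nat \<Rightarrow> 's hist \<Rightarrow> 's hist set" where
  "canon_proj T cbar P U t h = {h' \<in> hists T cbar t. odot T cbar P U t h h'}"

definition quotient_top :: "'a topology \<Rightarrow> ('a \<Rightarrow> 'b) \<Rightarrow> 'b topology" where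
  "quotient_top X p =
     topology (\<lambda>B. B \<subseteq> p ` topspace X \<and> openin X {x \<in> topspace X. p x \<in> B})"

text \<open>
  The state map and the step map are given through an arbitrary representative of the class;
  \<open>canon_st_proj\<close> and \<open>canon_step_proj\<close> below show that the choice is immaterial.
\<close>

definition canonical_sys ::
  "nat \<Rightarrow> real \<Rightarrow> 's grand_pref \<Rightarrow> 's util_sys \<Rightarrow> ('s hist set, 's) pa_sys" where
  "canonical_sys T cbar P U =
     \<lparr>pa_top = (\<lambda>t. quotient_top (hist_top T cbar t) (canon_proj T cbar P U t)),
      pa_st = (\<lambda>t x. phys_state (SOME h. h \<in> x)),
      pa_step = (\<lambda>t x c s. canon_proj T cbar P U (Suc t) (iota T t (SOME h. h \<in> x) c s))\<rparr>"

lemma openin_quotient_top: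
  "openin (quotient_top X p) B \<longleftrightarrow> B \<subseteq> p ` topspace X \<and> openin X {x \<in> topspace X. p x \<in> B}"
proof -
  let ?v = "\<lambda>B. {x \<in> topspace X. p x \<in> B}"
  have int: "?v (A \<inter> B) = ?v A \<inter> ?v B" and union: "?v (\<Union>K) = (\<Union>B\<in>K. ?v B)" for A B K
    by auto
  have "istopology (\<lambda>B. B \<subseteq> p ` topspace X \<and> openin X (?v B))"
    unfolding istopology_def int union by blast
  then show ?thesis
    by (simp add: quotient_top_def)
qed

lemma topspace_quotient_top: "topspace (quotient_top X p) = p ` topspace X"
proof
  show "topspace (quotient_top X p) \<subseteq> p ` topspace X"
    using openin_quotient_top[of X p "topspace (quotient_top X p)"] by simp
  have "{x \<in> topspace X. p x \<in> p ` topspace X} = topspace X" by auto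
  then have "openin (quotient_top X p) (p ` topspace X)"
    by (simp add: openin_quotient_top)
  then show "p ` topspace X \<subseteq> topspace (quotient_top X p)"
    by (rule openin_subset)
qed

lemma quotient_map_quotient_top: "quotient_map X (quotient_top X p) p"
  by (auto simp: quotient_map_def topspace_quotient_top openin_quotient_top)

lemma iota_in_hists:
  assumes "t \<le> T" "h \<in> hists T cbar t" "c \<in> {0..cbar}" "s \<in> states T (Suc t)"
  shows "iota T t h c s \<in> hists T cbar (Suc t)"
  using assms by (auto simp: hists_def iota_def topspace_pullback_topology)

lemma plans_Plan:
  assumes "t \<le> T"
  shows "plans T cbar t = {Plan c fp |c fp. c \<in> {0..cbar} \<and> fp \<in> conts T cbar (Suc t)}"
proof -
  have *: "Suc T - t = Suc (Suc T - Suc t)" using assms by simp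
  show ?thesis
    unfolding plans_def conts_def plan_top_def *
    by (auto simp: topspace_pullback_topology PiE_iff)
qed

lemma plans_terminal: "plans T cbar T = term_plan ` {0..cbar}"
proof -
  have "conts T cbar (Suc T) = {\<lambda>_. PEnd}"
    by (auto simp: conts_def plans_def plan_top_def)
  then show ?thesis
    by (auto simp: plans_Plan term_plan_def)
qed

lemma odot_final: "T < t \<Longrightarrow> odot T cbar P U t h h' \<longleftrightarrow> uterm U h = uterm U h'"
  by (subst odot.simps) simp

lemma odot_unfold:
  assumes "t \<le> T"
  shows "odot T cbar P U t h h' \<longleftrightarrow>
     phys_state h = phys_state h' \<and>
     (\<forall>f\<in>plans T cbar t. indiff P t (h, f) (h', f)) \<and>
     (\<forall>c\<in>{0..cbar}. \<forall>s\<in>states T (Suc t).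
        odot T cbar P U (Suc t) (iota T t h c s) (iota T t h' c s))"
  using assms by (subst odot.simps) simp

lemma odot_refl:
  assumes "weak_order T cbar P" "h \<in> hists T cbar t" "t \<le> Suc T"
  shows "odot T cbar P U t h h"
  using assms(2,3)
proof (induction "Suc T - t" arbitrary: t h)
  case 0
  then show ?case by (subst odot.simps) auto
next
  case (Suc n)
  from Suc.hyps(2) have t: "t \<le> T" "n = Suc T - Suc t" by simp_all
  have "indiff P t (h, f) (h, f)" if "f \<in> plans T cbar t" for f
  proof -
    have "(h, f) \<in> decs T cbar t" using Suc.prems that by (simp add: decs_def)
    then show ?thesis using assms(1) t(1) unfolding weak_order_def indiff_def by blast
  qed
  moreover have "odot T cbar P U (Suc t) (iota T t h c s) (iota T t h c s)"
    if "c \<in> {0..cbar}" "s \<in> states T (Suc t)" for c s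
    by (rule Suc.hyps(1)[OF t(2) iota_in_hists[OF t(1) Suc.prems(1) that]]) (use t in simp)
  ultimately show ?case
    using t by (simp add: odot_unfold)
qed

lemma odot_sym:
  assumes "odot T cbar P U t h h'"
  shows "odot T cbar P U t h' h"
  using assms
proof (induction "Suc T - t" arbitrary: t h h')
  case 0
  then have "T < t" by simp
  then show ?case
    using 0 odot_final by metis
next
  case (Suc n)
  from Suc.hyps(2) have t: "t \<le> T" "n = Suc T - Suc t" by simp_all
  show ?case
    using Suc.prems Suc.hyps(1)[OF t(2)] unfolding odot_unfold[OF t(1)] indiff_def by metis
qed

lemma odot_trans:
  assumes "weak_order T cbar P" "t \<le> Suc T"
    and "h \<in> hists T cbar t" "h' \<in> hists T cbar t" "h'' \<in> hists T cbar t"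
    and "odot T cbar P U t h h'" "odot T cbar P U t h' h''"
  shows "odot T cbar P U t h h''"
  using assms(2-)
proof (induction "Suc T - t" arbitrary: t h h' h'')
  case 0
  then have "T < t" by simp
  then show ?case
    using 0 odot_final by metis
next
  case (Suc n)
  from Suc.hyps(2) have t: "t \<le> T" "n = Suc T - Suc t" by simp_all
  note 1 = iffD1[OF odot_unfold[OF t(1)] Suc.prems(5)]
    and 2 = iffD1[OF odot_unfold[OF t(1)] Suc.prems(6)]
  have "indiff P t (h, f) (h'', f)" if f: "f \<in> plans T cbar t" for f
  proof -
    have "indiff P t (h, f) (h', f)" "indiff P t (h', f) (h'', f)"
      using 1 2 f by blast+
    moreover have "(h, f) \<in> decs T cbar t" "(h', f) \<in> decs T cbar t" "(h'', f) \<in> decs T cbar t"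
      using Suc.prems(2-4) f by (simp_all add: decs_def)
    moreover have "\<forall>a\<in>decs T cbar t. \<forall>b\<in>decs T cbar t. \<forall>d\<in>decs T cbar t.
        pref P t a b \<longrightarrow> pref P t b d \<longrightarrow> pref P t a d"
      by (rule conjunct2[OF mp[OF spec[OF assms(1)[unfolded weak_order_def]] t(1)]])
    ultimately show ?thesis
      unfolding indiff_def by meson
  qed
  moreover have "odot T cbar P U (Suc t) (iota T t h c s) (iota T t h'' c s)"
    if cs: "c \<in> {0..cbar}" "s \<in> states T (Suc t)" for c s
  proof (rule Suc.hyps(1)[OF t(2)])
    show "odot T cbar P U (Suc t) (iota T t h c s) (iota T t h' c s)"
      and "odot T cbar P U (Suc t) (iota T t h' c s) (iota T t h'' c s)"
      using 1 2 cs by blast+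
  qed (use t Suc.prems(1-4) cs in \<open>simp_all add: iota_in_hists\<close>)
  ultimately show ?case
    using 1 2 unfolding odot_unfold[OF t(1)] by simp
qed

lemma canon_proj_eq:
  assumes "weak_order T cbar P" "t \<le> Suc T" "h \<in> hists T cbar t" "h' \<in> hists T cbar t"
    and "odot T cbar P U t h h'"
  shows "canon_proj T cbar P U t h = canon_proj T cbar P U t h'"
  using odot_trans[OF assms(1,2)] odot_sym assms(3-5) unfolding canon_proj_def by blast

lemma canon_rep:
  fixes P :: "'s grand_pref" and U :: "'s util_sys"
  assumes "weak_order T cbar P" "t \<le> Suc T" "h \<in> hists T cbar t"
  defines "r \<equiv> SOME h'. h' \<in> canon_proj T cbar P U t h"
  shows "r \<in> hists T cbar t" "odot T cbar P U t h r"
proof -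
  have "h \<in> canon_proj T cbar P U t h"
    using odot_refl[OF assms(1,3,2)] assms(3) by (simp add: canon_proj_def)
  then have "r \<in> canon_proj T cbar P U t h"
    unfolding r_def by (rule someI)
  then show "r \<in> hists T cbar t" "odot T cbar P U t h r"
    by (auto simp: canon_proj_def)
qed

lemma phys_state_final: "h \<in> hists T cbar (Suc T) \<Longrightarrow> phys_state h = Star"
  by (auto simp: hists_def topspace_pullback_topology)

lemma canon_st_proj:
  assumes "weak_order T cbar P" "t \<le> Suc T" "h \<in> hists T cbar t"
  shows "pa_st (canonical_sys T cbar P U) t (canon_proj T cbar P U t h) = phys_state h"
proof (cases "t = Suc T")
  case True
  then show ?thesis
    using canon_rep(1)[OF assms, of U] assms(3) by (simp add: canonical_sys_def phys_state_final)
next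
  case False
  then show ?thesis
    using canon_rep(2)[OF assms, of U] assms(2) by (simp add: canonical_sys_def odot_unfold)
qed

lemma canon_step_proj:
  assumes "weak_order T cbar P" "t \<le> T" "h \<in> hists T cbar t"
    and "c \<in> {0..cbar}" "s \<in> states T (Suc t)"
  shows "pa_step (canonical_sys T cbar P U) t (canon_proj T cbar P U t h) c s =
         canon_proj T cbar P U (Suc t) (iota T t h c s)"
proof -
  define r where "r = (SOME h'. h' \<in> canon_proj T cbar P U t h)"
  have r: "r \<in> hists T cbar t" "odot T cbar P U t h r"
    using canon_rep[OF assms(1) _ assms(3), of U] assms(2) by (auto simp: r_def)
  then have "odot T cbar P U (Suc t) (iota T t h c s) (iota T t r c s)"
    using assms(2,4,5) odot_unfold by blast
  then have "canon_proj T cbar P U (Suc t) (iota T t h c s) =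
      canon_proj T cbar P U (Suc t) (iota T t r c s)"
    using assms r by (intro canon_proj_eq iota_in_hists) auto
  then show ?thesis
    by (simp add: canonical_sys_def r_def)
qed

end

theory Submission
  imports Defs
begin

text \<open>
  Taking suprema over the compact spaces of plans and continuations turns the recursive definition
  of \<open>odot\<close> into a continuous pseudometric \<open>d\<close> on histories whose zero set is \<open>odot\<close>; hence the
  canonical quotients are metrizable.  Richness makes the certainty equivalent of a plan, and its
  utility as a function of consumption and certainty equivalent, constant on \<open>odot\<close>-classes and
  monotone.  Both are defined on a compact subset \<open>D\<close> of a product of the history space with
  real factors.  On such a product, \<open>\<rho> p q = d h h' + \<Sum>(u - u')\<^sup>+\<close> is a continuous
  quasi-pseudometric, and \<open>\<rho> p q = 0\<close> says that \<open>p\<close> and \<open>q\<close> have equivalent histories and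
  \<open>u \<le> u'\<close>.  A continuous \<open>m\<close> on \<open>D\<close> that is monotone for this preorder has, by compactness, for
  every \<open>a > 0\<close> some \<open>b\<close> with \<open>m p \<le> m q + a + b * \<rho> p q\<close> on \<open>D\<close>, and the McShane-type formula
  \<open>F p = inf (m q + a + b * \<rho> p q)\<close>, over \<open>q\<close> in \<open>D\<close> and all such \<open>a, b\<close>, is a continuous monotone
  extension to the whole product.  Being monotone for \<open>\<rho>\<close>, it descends to the quotient.
\<close>

section \<open>Continuous quasi-pseudometrics\<close>

text \<open>Neither symmetry nor separation is imposed, so the relation
  \<open>\<rho> x y = 0\<close> is a general preorder on \<open>topspace X\<close>. It will be an
  equivalence in the history coordinate and an order in the utility coordinates.\<close>

definition continuous_qpmetric :: "'a topology \<Rightarrow> ('a \<Rightarrow> 'a \<Rightarrow> real) \<Rightarrow> bool" where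
  "continuous_qpmetric X \<rho> \<longleftrightarrow>
     continuous_map (prod_topology X X) euclideanreal (\<lambda>(x, y). \<rho> x y) \<and>
     (\<forall>x\<in>topspace X. \<rho> x x = 0) \<and>
     (\<forall>x\<in>topspace X. \<forall>y\<in>topspace X. 0 \<le> \<rho> x y) \<and>
     (\<forall>x\<in>topspace X. \<forall>y\<in>topspace X. \<forall>z\<in>topspace X. \<rho> x z \<le> \<rho> x y + \<rho> y z)"

lemma continuous_qpmetricD:
  assumes "continuous_qpmetric X \<rho>"
  shows continuous_qpmetric_continuous:
      "continuous_map (prod_topology X X) euclideanreal (\<lambda>(x, y). \<rho> x y)"
    and continuous_qpmetric_refl: "x \<in> topspace X \<Longrightarrow> \<rho> x x = 0"
    and continuous_qpmetric_nonneg: "x \<in> topspace X \<Longrightarrow> y \<in> topspace X \<Longrightarrow> 0 \<le> \<rho> x y"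
    and continuous_qpmetric_triangle:
      "x \<in> topspace X \<Longrightarrow> y \<in> topspace X \<Longrightarrow> z \<in> topspace X \<Longrightarrow> \<rho> x z \<le> \<rho> x y + \<rho> y z"
  using assms unfolding continuous_qpmetric_def by blast+

lemma continuous_qpmetric_compose_continuous_map:
  assumes "continuous_qpmetric X \<rho>" "continuous_map Z X f" "continuous_map Z X g"
  shows "continuous_map Z euclideanreal (\<lambda>z. \<rho> (f z) (g z))"
  using continuous_map_compose[OF continuous_map_pairedI[OF assms(2,3)]
      continuous_qpmetric_continuous[OF assms(1)]]
  by (simp add: o_def)

lemma continuous_qpmetric_pullback:
  assumes "continuous_qpmetric Z \<rho>" "continuous_map X Z e"
  shows "continuous_qpmetric X (\<lambda>x y. \<rho> (e x) (e y))"
proof -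
  have e: "e x \<in> topspace Z" if "x \<in> topspace X" for x
    using continuous_map_image_subset_topspace[OF assms(2)] that by blast
  have "continuous_map (prod_topology X X) euclideanreal (\<lambda>p. \<rho> (e (fst p)) (e (snd p)))"
    by (intro continuous_qpmetric_compose_continuous_map[OF assms(1)]
        continuous_map_compose[OF continuous_map_fst assms(2), unfolded o_def]
        continuous_map_compose[OF continuous_map_snd assms(2), unfolded o_def])
  then show ?thesis
    unfolding continuous_qpmetric_def case_prod_unfold
    using continuous_qpmetricD[OF assms(1)] e by auto
qed

lemma continuous_qpmetric_add:
  assumes "continuous_qpmetric X \<rho>" "continuous_qpmetric X \<rho>'"
  shows "continuous_qpmetric X (\<lambda>x y. \<rho> x y + \<rho>' x y)"
  unfolding continuous_qpmetric_def
proof (intro conjI ballI)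
  show "continuous_map (prod_topology X X) euclideanreal (\<lambda>(x, y). \<rho> x y + \<rho>' x y)"
    using continuous_map_add[OF assms[THEN continuous_qpmetric_continuous]]
    by (simp add: case_prod_unfold)
next
  fix x y z assume "x \<in> topspace X" "y \<in> topspace X" "z \<in> topspace X"
  then show "\<rho> x z + \<rho>' x z \<le> \<rho> x y + \<rho>' x y + (\<rho> y z + \<rho>' y z)"
    using assms[THEN continuous_qpmetric_triangle, of x y z] by simp
qed (use continuous_qpmetricD[OF assms(1)] continuous_qpmetricD[OF assms(2)] in auto)

lemma continuous_qpmetric_sum:
  assumes "finite I" "\<And>i. i \<in> I \<Longrightarrow> continuous_qpmetric X (\<rho> i)"
  shows "continuous_qpmetric X (\<lambda>x y. \<Sum>i\<in>I. \<rho> i x y)"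
  using assms
proof (induction I rule: finite_induct)
  case empty
  then show ?case by (simp add: continuous_qpmetric_def case_prod_unfold)
next
  case (insert i I)
  then show ?case by (simp add: continuous_qpmetric_add)
qed

text \<open>The zero relation of this asymmetric distance is \<open>x \<le> y\<close>. It serves in
  coordinates where monotonicity is wanted, while the absolute difference below serves where only
  equal values are to be compared.\<close>

lemma continuous_qpmetric_posdiff: "continuous_qpmetric euclideanreal (\<lambda>x y. max 0 (x - y))"
  unfolding continuous_qpmetric_def case_prod_unfold
  by (auto intro!: continuous_intros continuous_map_fst continuous_map_snd)

lemma continuous_qpmetric_absdiff: "continuous_qpmetric euclideanreal (\<lambda>x y. \<bar>x - y\<bar>)"
  unfolding continuous_qpmetric_def case_prod_unfold
  by (auto intro!: continuous_intros continuous_map_fst continuous_map_snd)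

lemma continuous_qpmetric_discrete:
  "continuous_qpmetric (discrete_topology A) (\<lambda>x y. if x = y then 0 else 1)"
  unfolding continuous_qpmetric_def
  by (auto simp: case_prod_unfold simp flip: prod_topology_discrete_topology)

section \<open>Suprema over a compact factor\<close>

lemma continuous_real_attains_sup:
  assumes "compact_space K" "topspace K \<noteq> {}" "continuous_map K euclideanreal g"
  obtains k where "k \<in> topspace K" "\<And>k'. k' \<in> topspace K \<Longrightarrow> g k' \<le> g k"
proof -
  have "compact (g ` topspace K)"
    using image_compactin[OF _ assms(3), of "topspace K"] assms(1) by (simp add: compact_space_def)
  then obtain s where "s \<in> g ` topspace K" "\<forall>t \<in> g ` topspace K. t \<le> s"
    using compact_attains_sup[of "g ` topspace K"] assms(2) by blast
  then show ?thesis using that by blast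
qed

lemma continuous_real_bdd_above:
  assumes "compact_space K" "continuous_map K euclideanreal g"
  shows "bdd_above (g ` topspace K)"
  using image_compactin[OF _ assms(2), of "topspace K"] assms(1)
  by (simp add: compact_space_def bounded_imp_bdd_above compact_imp_bounded)

lemma continuous_map_section:
  assumes "continuous_map (prod_topology X K) Y g" "x \<in> topspace X"
  shows "continuous_map K Y (\<lambda>k. g (x, k))"
  using continuous_map_compose[OF continuous_map_pairedI[OF _ continuous_map_id[unfolded id_def]] assms(1), 
      of "\<lambda>_. x"] assms(2)
  by (simp add: o_def)

text \<open>The set where the supremum exceeds \<open>a\<close> is the projection of an open set,
  and projections are open. As the supremum is attained, the set where it is at least
  \<open>a\<close> is the projection of a closed set, and projection along a compact factor is
  closed.\<close>

lemma continuous_map_SUP_compact: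
  fixes g :: "'a \<times> 'k \<Rightarrow> real"
  assumes "compact_space K" "topspace K \<noteq> {}"
    and g: "continuous_map (prod_topology X K) euclideanreal g"
  shows "continuous_map X euclideanreal (\<lambda>x. SUP k\<in>topspace K. g (x, k))"
    (is "continuous_map _ _ ?S")
proof -
  have att: "\<exists>k\<in>topspace K. ?S x = g (x, k)" and ub: "\<forall>k\<in>topspace K. g (x, k) \<le> ?S x"
    if x: "x \<in> topspace X" for x
  proof -
    note c = continuous_map_section[OF g x]
    show u: "\<forall>k\<in>topspace K. g (x, k) \<le> ?S x"
      using continuous_real_bdd_above[OF assms(1) c] by (auto intro: cSUP_upper)
    obtain k where k: "k \<in> topspace K" "\<And>k'. k' \<in> topspace K \<Longrightarrow> g (x, k') \<le> g (x, k)"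
      using continuous_real_attains_sup[OF assms(1,2) c] by blast
    have "?S x \<le> g (x, k)" using k assms(2) by (intro cSUP_least) auto
    then show "\<exists>k\<in>topspace K. ?S x = g (x, k)" using u k by force
  qed
  show ?thesis
    unfolding continuous_map_upper_lower_semicontinuous_lt
  proof (intro conjI allI)
    fix a
    have "openin (prod_topology X K) {p \<in> topspace (prod_topology X K). g p > a}"
      using g unfolding continuous_map_upper_lower_semicontinuous_lt by blast
    then have "openin X (fst ` {p \<in> topspace (prod_topology X K). g p > a})"
      using open_map_fst unfolding open_map_def by blast
    moreover have "fst ` {p \<in> topspace (prod_topology X K). g p > a} = {x \<in> topspace X. ?S x > a}"
    proof (intro equalityI subsetI)
      fix x assume "x \<in> {x \<in> topspace X. ?S x > a}"
      moreover then obtain k where "k \<in> topspace K" "?S x = g (x, k)" using att by blast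
      ultimately show "x \<in> fst ` {p \<in> topspace (prod_topology X K). g p > a}"
        by (intro image_eqI[of _ _ "(x, k)"]) auto
    next
      fix x assume "x \<in> fst ` {p \<in> topspace (prod_topology X K). g p > a}"
      then obtain k where "x \<in> topspace X" "k \<in> topspace K" "g (x, k) > a" by auto
      then show "x \<in> {x \<in> topspace X. ?S x > a}" using ub by force
    qed
    ultimately show "openin X {x \<in> topspace X. ?S x > a}" by simp
    have "closedin (prod_topology X K) {p \<in> topspace (prod_topology X K). g p \<ge> a}"
      using g unfolding continuous_map_upper_lower_semicontinuous_le by blast
    then have "closedin X (fst ` {p \<in> topspace (prod_topology X K). g p \<ge> a})"
      using closed_map_fst[OF assms(1)] unfolding closed_map_def by blast
    then have "openin X (topspace X - fst ` {p \<in> topspace (prod_topology X K). g p \<ge> a})"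
      by blast
    moreover have "topspace X - fst ` {p \<in> topspace (prod_topology X K). g p \<ge> a} = {x \<in> topspace X. ?S x < a}"
    proof (intro equalityI subsetI)
      fix x assume x: "x \<in> topspace X - fst ` {p \<in> topspace (prod_topology X K). g p \<ge> a}"
      moreover then obtain k where "k \<in> topspace K" "?S x = g (x, k)" using att by blast
      moreover have "(x, k) \<notin> {p \<in> topspace (prod_topology X K). g p \<ge> a}"
        using x by force
      ultimately show "x \<in> {x \<in> topspace X. ?S x < a}" by auto
    next
      fix x assume "x \<in> {x \<in> topspace X. ?S x < a}"
      then show "x \<in> topspace X - fst ` {p \<in> topspace (prod_topology X K). g p \<ge> a}"
        using ub by force
    qed
    ultimately show "openin X {x \<in> topspace X. ?S x < a}" by simp
  qed
qed

text \<open>This turns a universal quantifier over a compact space into a zero set: the terms are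
  nonnegative, so their supremum vanishes exactly when all of them do. Compactness keeps the
  supremum finite, and the triangle inequality passes to it term by term.\<close>

lemma continuous_qpmetric_SUP:
  fixes e :: "'a \<times> 'k \<Rightarrow> 'z"
  assumes "compact_space K" "topspace K \<noteq> {}" and \<rho>: "continuous_qpmetric Z \<rho>"
    and e: "continuous_map (prod_topology X K) Z e"
  defines "\<tau> \<equiv> \<lambda>x y. SUP k\<in>topspace K. \<rho> (e (x, k)) (e (y, k))"
  shows "continuous_qpmetric X \<tau>"
    and "x \<in> topspace X \<Longrightarrow> y \<in> topspace X \<Longrightarrow>
      \<tau> x y = 0 \<longleftrightarrow> (\<forall>k\<in>topspace K. \<rho> (e (x, k)) (e (y, k)) = 0)"
proof -
  have eZ: "e (x, k) \<in> topspace Z" if "x \<in> topspace X" "k \<in> topspace K" for x k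
    using continuous_map_image_subset_topspace[OF e] that by auto
  have cont: "continuous_map (prod_topology (prod_topology X X) K) euclideanreal
      (\<lambda>q. \<rho> (e (fst (fst q), snd q)) (e (snd (fst q), snd q)))"
    by (intro continuous_qpmetric_compose_continuous_map[OF \<rho>]
        continuous_map_compose[OF _ e, unfolded o_def] continuous_map_pairedI
        continuous_map_snd continuous_map_compose[OF continuous_map_fst continuous_map_fst, unfolded o_def]
        continuous_map_compose[OF continuous_map_fst continuous_map_snd, unfolded o_def])
  have ub: "\<rho> (e (x, k)) (e (y, k)) \<le> \<tau> x y"
    if "x \<in> topspace X" "y \<in> topspace X" "k \<in> topspace K" for x y k
    unfolding \<tau>_def
    using continuous_real_bdd_above[OF assms(1) continuous_map_section[OF cont, of "(x, y)"]] that
    by (auto intro: cSUP_upper)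
  have lub: "\<tau> x y \<le> a" if "\<And>k. k \<in> topspace K \<Longrightarrow> \<rho> (e (x, k)) (e (y, k)) \<le> a" for x y a
    unfolding \<tau>_def by (rule cSUP_least[OF assms(2) that])
  have nn: "0 \<le> \<tau> x y" if "x \<in> topspace X" "y \<in> topspace X" for x y
  proof -
    obtain k where k: "k \<in> topspace K" using assms(2) by blast
    have "0 \<le> \<rho> (e (x, k)) (e (y, k))"
      by (rule continuous_qpmetric_nonneg[OF \<rho>]) (use eZ that k in auto)
    then show ?thesis using ub[OF that k] by simp
  qed
  show zero: "\<tau> x y = 0 \<longleftrightarrow> (\<forall>k\<in>topspace K. \<rho> (e (x, k)) (e (y, k)) = 0)"
    if "x \<in> topspace X" "y \<in> topspace X" for x y
  proof
    assume "\<tau> x y = 0"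
    then show "\<forall>k\<in>topspace K. \<rho> (e (x, k)) (e (y, k)) = 0"
      using ub[OF that] continuous_qpmetric_nonneg[OF \<rho> eZ[OF that(1)] eZ[OF that(2)]]
      by (metis order_antisym)
  next
    assume "\<forall>k\<in>topspace K. \<rho> (e (x, k)) (e (y, k)) = 0"
    then show "\<tau> x y = 0" by (intro antisym nn that lub) auto
  qed
  show "continuous_qpmetric X \<tau>"
    unfolding continuous_qpmetric_def
  proof (intro conjI ballI)
    show "continuous_map (prod_topology X X) euclideanreal (\<lambda>(x, y). \<tau> x y)"
      using continuous_map_SUP_compact[OF assms(1,2) cont] by (simp add: \<tau>_def case_prod_unfold)
    show "\<tau> x x = 0" if "x \<in> topspace X" for x
      using zero[OF that that] continuous_qpmetric_refl[OF \<rho> eZ[OF that]] by simp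
    show "\<tau> x z \<le> \<tau> x y + \<tau> y z"
      if "x \<in> topspace X" "y \<in> topspace X" "z \<in> topspace X" for x y z
    proof (rule lub)
      fix k assume k: "k \<in> topspace K"
      show "\<rho> (e (x, k)) (e (z, k)) \<le> \<tau> x y + \<tau> y z"
        using continuous_qpmetric_triangle[OF \<rho> eZ[OF that(1) k] eZ[OF that(2) k] eZ[OF that(3) k]]
          ub[OF that(1,2) k] ub[OF that(2,3) k] by linarith
    qed
  qed (rule nn)
qed

text \<open>The symmetrised \<open>d\<close>, read off at representatives, is a metric on the points
  of \<open>Y\<close>. The map \<open>p\<close> is continuous from a compact space onto this
  Hausdorff metric space, hence closed, hence a quotient map. A quotient topology is determined by
  its map, so the metric topology is \<open>Y\<close>.\<close>

lemma metrizable_quotient_of_qpmetric: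
  assumes X: "compact_space X" and d: "continuous_qpmetric X d"
    and q: "quotient_map X Y p"
    and eq: "\<And>x y. x \<in> topspace X \<Longrightarrow> y \<in> topspace X \<Longrightarrow> p x = p y \<longleftrightarrow> d x y = 0"
  shows "metrizable_space Y"
proof -
  have im: "p ` topspace X = topspace Y" using q by (rule quotient_imp_surjective_map)
  define r where "r = inv_into (topspace X) p"
  have r: "r y \<in> topspace X" "p (r y) = y" if "y \<in> topspace Y" for y
    using that im unfolding r_def by (auto intro: inv_into_into f_inv_into_f)
  have dr0: "d x (r (p x)) = 0" "d (r (p x)) x = 0" if "x \<in> topspace X" for x
    using that im r[of "p x"] eq[of x "r (p x)"] eq[of "r (p x)" x] by (metis imageI)+
  \<comment> \<open>Replacing points by their representatives adds legs of length \<open>0\<close>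
    in either direction, so two triangle inequalities bound each side by the other.\<close>
  have dr: "d (r (p x)) (r (p x')) = d x x'" if "x \<in> topspace X" "x' \<in> topspace X" for x x'
  proof -
    have rr: "r (p x) \<in> topspace X" "r (p x') \<in> topspace X" using r im that by auto
    show ?thesis
      using continuous_qpmetric_triangle[OF d rr(1) that(1) rr(2)]
        continuous_qpmetric_triangle[OF d that(1) that(2) rr(2)]
        continuous_qpmetric_triangle[OF d that(1) rr(1) that(2)]
        continuous_qpmetric_triangle[OF d rr(1) rr(2) that(2)]
        dr0[OF that(1)] dr0[OF that(2)] by linarith
  qed
  \<comment> \<open>The locale \<open>Metric_space\<close> asks for nonnegativity and symmetry at
    all points of the type, whence the value \<open>0\<close> off \<open>topspace Y\<close>.\<close>
  define \<delta> where "\<delta> = (\<lambda>y y'. if y \<in> topspace Y \<and> y' \<in> topspace Y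
    then d (r y) (r y') + d (r y') (r y) else 0)"
  have nn: "0 \<le> d (r y) (r y')" if "y \<in> topspace Y" "y' \<in> topspace Y" for y y'
    using continuous_qpmetric_nonneg[OF d] r that by blast
  interpret m: Metric_space "topspace Y" \<delta>
  proof
    show "0 \<le> \<delta> x y" "\<delta> x y = \<delta> y x" for x y
      using nn by (auto simp: \<delta>_def)
    show "\<delta> x y = 0 \<longleftrightarrow> x = y" if "x \<in> topspace Y" "y \<in> topspace Y" for x y
      using that nn[OF that] nn[OF that(2,1)] r eq[of "r x" "r y"] eq[of "r y" "r x"]
      by (auto simp: \<delta>_def add_nonneg_eq_0_iff)
    show "\<delta> x z \<le> \<delta> x y + \<delta> y z"
      if "x \<in> topspace Y" "y \<in> topspace Y" "z \<in> topspace Y" for x y z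
      using that r continuous_qpmetric_triangle[OF d, of "r x" "r y" "r z"]
        continuous_qpmetric_triangle[OF d, of "r z" "r y" "r x"]
      by (auto simp: \<delta>_def)
  qed
  have "continuous_map X m.mtopology p"
    unfolding m.continuous_map_to_metric
  proof (intro ballI allI impI)
    fix x \<epsilon> assume x: "x \<in> topspace X" and \<epsilon>: "(0::real) < \<epsilon>"
    let ?U = "{x' \<in> topspace X. d x x' + d x' x < \<epsilon>}"
    have "continuous_map X euclideanreal (\<lambda>x'. d x x' + d x' x)"
      using x by (intro continuous_map_add continuous_qpmetric_compose_continuous_map[OF d]) auto
    then have "openin X ?U"
      unfolding continuous_map_upper_lower_semicontinuous_lt by blast
    moreover have "x \<in> ?U"
      using x \<epsilon> continuous_qpmetric_refl[OF d x] by simp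
    moreover have "\<forall>y\<in>?U. p y \<in> m.mball (p x) \<epsilon>"
      using x im dr by (auto simp: m.in_mball) (auto simp: \<delta>_def)
    ultimately show "\<exists>U. openin X U \<and> x \<in> U \<and> (\<forall>y\<in>U. p y \<in> m.mball (p x) \<epsilon>)"
      by blast
  qed
  then have "quotient_map X m.mtopology p"
    by (intro continuous_closed_imp_quotient_map continuous_imp_closed_map_gen X
        Hausdorff_imp_kc_space m.Hausdorff_space_mtopology) (simp_all add: im)
  with q have "openin Y V \<longleftrightarrow> openin m.mtopology V" for V
    unfolding quotient_map_def using openin_subset m.topspace_mtopology by metis
  then have "Y = m.mtopology" by (simp add: topology_eq)
  then show ?thesis using m.metrizable_space_mtopology by simp
qed

text \<open>On the compact set \<open>Z\<close> of pairs with \<open>m k - m k' \<ge> a\<close>, the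
  distance has a positive minimum \<open>\<delta>\<close>, because a zero distance would give
  \<open>m k \<le> m k'\<close>. With an upper bound \<open>B\<close> of all differences, the slope
  \<open>B / \<delta>\<close> suffices on \<open>Z\<close>, and off \<open>Z\<close> the offset
  \<open>a\<close> suffices alone.\<close>

lemma compact_affine_modulus:
  fixes m :: "'k \<Rightarrow> real"
  assumes K: "compact_space K" and \<rho>: "continuous_qpmetric K \<rho>"
    and m: "continuous_map K euclideanreal m"
    and mono: "\<And>k k'. k \<in> topspace K \<Longrightarrow> k' \<in> topspace K \<Longrightarrow> \<rho> k k' = 0 \<Longrightarrow> m k \<le> m k'"
    and "0 < a"
  shows "\<exists>b\<ge>0. \<forall>k\<in>topspace K. \<forall>k'\<in>topspace K. m k \<le> m k' + a + b * \<rho> k k'"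
proof -
  let ?KK = "prod_topology K K"
  let ?g = "\<lambda>p. m (fst p) - m (snd p)"
  define Z where "Z = {p \<in> topspace ?KK. a \<le> ?g p}"
  have KK: "compact_space ?KK" using K by (simp add: compact_space_prod_topology)
  have g: "continuous_map ?KK euclideanreal ?g"
    by (intro continuous_map_diff continuous_map_compose[OF continuous_map_fst m, unfolded o_def]
        continuous_map_compose[OF continuous_map_snd m, unfolded o_def])
  have "closedin ?KK Z"
    unfolding Z_def using g unfolding continuous_map_upper_lower_semicontinuous_le by blast
  then have cZ: "compact_space (subtopology ?KK Z)"
    using KK closedin_compact_space compact_space_subtopology by blast
  have tZ: "topspace (subtopology ?KK Z) = Z" unfolding Z_def by auto
  \<comment> \<open>The sign is reversed so that the attained supremum yields a minimiser of the
    distance on \<open>Z\<close>.\<close>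
  have c\<rho>: "continuous_map (subtopology ?KK Z) euclideanreal (\<lambda>p. - (\<rho> (fst p) (snd p)))"
    using continuous_qpmetric_continuous[OF \<rho>]
    by (intro continuous_map_minus continuous_map_from_subtopology) (simp add: case_prod_unfold)
  show ?thesis
  proof (cases "Z = {}")
    case True
    have "m k \<le> m k' + a + 0 * \<rho> k k'" if "k \<in> topspace K" "k' \<in> topspace K" for k k'
    proof -
      have "(k, k') \<notin> Z" using True by simp
      then show ?thesis using that by (simp add: Z_def)
    qed
    then show ?thesis by (intro exI[of _ 0]) simp
  next
    case False
    obtain z where z: "z \<in> Z" "\<And>z'. z' \<in> Z \<Longrightarrow> \<rho> (fst z) (snd z) \<le> \<rho> (fst z') (snd z')"
      using continuous_real_attains_sup[OF cZ _ c\<rho>, unfolded tZ neg_le_iff_le, OF False] by blast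
    define \<delta> where "\<delta> = \<rho> (fst z) (snd z)"
    have "\<delta> > 0"
    proof -
      have zz: "fst z \<in> topspace K" "snd z \<in> topspace K" using z(1) by (auto simp: Z_def)
      have "0 \<le> \<delta>" unfolding \<delta>_def by (rule continuous_qpmetric_nonneg[OF \<rho> zz])
      moreover have "\<delta> \<noteq> 0"
        using mono[OF zz] z(1) \<open>0 < a\<close> unfolding \<delta>_def Z_def by force
      ultimately show ?thesis by simp
    qed
    obtain B where B: "\<And>p. p \<in> topspace ?KK \<Longrightarrow> ?g p \<le> B"
      using continuous_real_bdd_above[OF KK g] unfolding bdd_above_def by blast
    have B0: "0 \<le> B" using B[of z] z(1) \<open>0 < a\<close> by (simp add: Z_def)
    have "m k \<le> m k' + a + B / \<delta> * \<rho> k k'" if k: "k \<in> topspace K" "k' \<in> topspace K" for k k'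
    proof (cases "(k, k') \<in> Z")
      case True
      have "B / \<delta> * \<delta> \<le> B / \<delta> * \<rho> k k'"
        using z(2)[OF True] B0 \<open>\<delta> > 0\<close> by (intro mult_left_mono) (auto simp: \<delta>_def)
      then have "B \<le> B / \<delta> * \<rho> k k'" using \<open>\<delta> > 0\<close> by simp
      then show ?thesis using B[of "(k, k')"] k \<open>0 < a\<close> by simp
    next
      case False
      have "0 \<le> B / \<delta> * \<rho> k k'"
        using B0 \<open>\<delta> > 0\<close> continuous_qpmetric_nonneg[OF \<rho> k] by simp
      then show ?thesis using False k by (simp add: Z_def)
    qed
    then show ?thesis using B0 \<open>\<delta> > 0\<close> by (intro exI[of _ "B / \<delta>"]) simp
  qed
qed

text \<open>The compact space \<open>K\<close> parametrises the set to extend from, and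
  \<open>e\<close> may identify points: if \<open>e k = e k'\<close>, the distance is
  \<open>0\<close> both ways, so \<open>mono\<close> forces \<open>m k = m k'\<close>. A function
  that is merely continuous need not be Lipschitz, hence the offsets \<open>a\<close>. Every affine
  modulus of \<open>m\<close> turns out to be one of \<open>F\<close>, which gives both continuity
  and monotonicity.\<close>

lemma monotone_extension:
  fixes m :: "'k \<Rightarrow> real"
  assumes K: "compact_space K" and \<rho>: "continuous_qpmetric X \<rho>"
    and e: "continuous_map K X e" and m: "continuous_map K euclideanreal m"
    and mono: "\<And>k k'. k \<in> topspace K \<Longrightarrow> k' \<in> topspace K \<Longrightarrow> \<rho> (e k) (e k') = 0 \<Longrightarrow> m k \<le> m k'"
  obtains F where "continuous_map X euclideanreal F"
    and "\<And>x y. x \<in> topspace X \<Longrightarrow> y \<in> topspace X \<Longrightarrow> \<rho> x y = 0 \<Longrightarrow> F x \<le> F y"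
    and "\<And>k. k \<in> topspace K \<Longrightarrow> F (e k) = m k"
proof (cases "topspace K = {}")
  case True
  show ?thesis by (rule that[of "\<lambda>_. 0"]) (use True in auto)
next
  case False
  \<comment> \<open>The pairs \<open>(a, b)\<close> in \<open>A\<close> are the affine moduli of
    \<open>m\<close>; by compactness every \<open>a > 0\<close> occurs as an offset.\<close>
  define A where "A = {(a, b). 0 \<le> a \<and> 0 \<le> b \<and>
    (\<forall>k\<in>topspace K. \<forall>k'\<in>topspace K. m k \<le> m k' + a + b * \<rho> (e k) (e k'))}"
  define G where "G = (\<lambda>x (k, a, b). m k + a + b * \<rho> x (e k))"
  define F where "F = (\<lambda>x. INF i\<in>topspace K \<times> A. G x i)"
  have modulus: "\<exists>b. (a, b) \<in> A" if "0 < a" for a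
  proof -
    have "\<exists>b\<ge>0. \<forall>k\<in>topspace K. \<forall>k'\<in>topspace K. m k \<le> m k' + a + b * \<rho> (e k) (e k')"
      by (rule compact_affine_modulus[OF K continuous_qpmetric_pullback[OF \<rho> e] m])
        (use mono that in blast)+
    then show ?thesis using that by (auto simp: A_def)
  qed
  then have ne: "topspace K \<times> A \<noteq> {}" using False zero_less_one by blast
  have eX: "e k \<in> topspace X" if "k \<in> topspace K" for k
    using continuous_map_image_subset_topspace[OF e] that by blast
  obtain B where B: "\<And>k. k \<in> topspace K \<Longrightarrow> - m k \<le> B"
    using continuous_real_bdd_above[OF K continuous_map_minus[OF m]]
    unfolding bdd_above_def by auto
  have bdd: "bdd_below (G x ` (topspace K \<times> A))" if x: "x \<in> topspace X" for x
  proof (rule bdd_belowI2)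
    fix i assume "i \<in> topspace K \<times> A"
    then obtain k a b where i: "i = (k, a, b)" "k \<in> topspace K" "0 \<le> a" "0 \<le> b"
      by (auto simp: A_def)
    then have "0 \<le> b * \<rho> x (e k)" using continuous_qpmetric_nonneg[OF \<rho> x eX] by simp
    then show "- B \<le> G x i" using i B[of k] by (simp add: G_def)
  qed
  have F_le: "F x \<le> m k + a + b * \<rho> x (e k)"
    if "x \<in> topspace X" "k \<in> topspace K" "(a, b) \<in> A" for x k a b
    using cINF_lower[OF bdd[OF that(1)], of "(k, a, b)"] that by (simp add: F_def G_def)
  have F_ge: "z \<le> F x"
    if "\<And>k a b. k \<in> topspace K \<Longrightarrow> (a, b) \<in> A \<Longrightarrow> z \<le> m k + a + b * \<rho> x (e k)" for x z
    unfolding F_def by (rule cINF_greatest[OF ne]) (use that in \<open>auto simp: G_def\<close>)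
  \<comment> \<open>Of two affine moduli the one with the smaller slope absorbs the triangle inequality.\<close>
  have F_mod: "F x \<le> F y + a + b * \<rho> x y"
    if x: "x \<in> topspace X" and y: "y \<in> topspace X" and ab: "(a, b) \<in> A" for x y a b
  proof -
    have "F x - (a + b * \<rho> x y) \<le> F y"
    proof (rule F_ge)
      fix k a' b' assume k: "k \<in> topspace K" and ab': "(a', b') \<in> A"
      have pos: "0 \<le> a" "0 \<le> b" "0 \<le> a'" "0 \<le> b'" using ab ab' by (auto simp: A_def)
      have nn: "0 \<le> \<rho> x y" "0 \<le> \<rho> y (e k)"
        using continuous_qpmetric_nonneg[OF \<rho>] x y eX[OF k] by auto
      have tri: "\<rho> x (e k) \<le> \<rho> x y + \<rho> y (e k)"
        by (rule continuous_qpmetric_triangle[OF \<rho> x y eX[OF k]])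
      show "F x - (a + b * \<rho> x y) \<le> m k + a' + b' * \<rho> y (e k)"
      proof (cases "b \<le> b'")
        case True
        have "F x \<le> m k + a + b * (\<rho> x y + \<rho> y (e k))"
          using F_le[OF x k ab] mult_left_mono[OF tri pos(2)] by linarith
        then show ?thesis
          using mult_right_mono[OF True nn(2)] pos by (simp add: algebra_simps)
      next
        case False
        have "F x \<le> m k + a' + b' * (\<rho> x y + \<rho> y (e k))"
          using F_le[OF x k ab'] mult_left_mono[OF tri pos(4)] by linarith
        then show ?thesis
          using mult_right_mono[of b' b, OF _ nn(1)] False pos by (simp add: algebra_simps)
      qed
    qed
    then show ?thesis by simp
  qed
  show ?thesis
  proof (rule that)
    show "F x \<le> F y" if "x \<in> topspace X" "y \<in> topspace X" "\<rho> x y = 0" for x y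
    proof (rule field_le_epsilon)
      fix a :: real assume "0 < a"
      then obtain b where "(a, b) \<in> A" using modulus by blast
      then show "F x \<le> F y + a" using F_mod[OF that(1,2)] that(3) by fastforce
    qed
    \<comment> \<open>Each affine bound defining \<open>A\<close> makes \<open>m k\<close> a lower
      bound of the infimum. Conversely, the point \<open>k\<close> itself, at distance
      \<open>0\<close> from its image, brings the infimum below \<open>m k + a\<close> for every
      \<open>a > 0\<close>.\<close>
    show "F (e k) = m k" if k: "k \<in> topspace K" for k
    proof (rule antisym)
      show "m k \<le> F (e k)"
        by (rule F_ge) (use k in \<open>auto simp: A_def\<close>)
      show "F (e k) \<le> m k"
      proof (rule field_le_epsilon)
        fix a :: real assume "0 < a"
        then obtain b where "(a, b) \<in> A" using modulus by blast
        then show "F (e k) \<le> m k + a"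
          using F_le[OF eX[OF k] k] continuous_qpmetric_refl[OF \<rho> eX[OF k]] by fastforce
      qed
    qed
    have "continuous_map X Met_TC.mtopology F"
      unfolding Met_TC.continuous_map_to_metric
    proof (intro ballI allI impI)
      fix x \<epsilon> assume x: "x \<in> topspace X" and \<epsilon>: "(0::real) < \<epsilon>"
      \<comment> \<open>Half of \<open>\<epsilon>\<close> is spent on the offset and half on the
        slope term. The neighbourhood involves both \<open>\<rho> x y\<close> and
        \<open>\<rho> y x\<close>, since \<open>F_mod\<close> is one-sided and is applied in both
        directions.\<close>
      obtain b where b: "(\<epsilon> / 2, b) \<in> A" using modulus[of "\<epsilon> / 2"] \<epsilon> by auto
      let ?U = "{y \<in> topspace X. b * (\<rho> x y + \<rho> y x) < \<epsilon> / 2}"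
      have "continuous_map X euclideanreal (\<lambda>y. b * (\<rho> x y + \<rho> y x))"
        using x by (intro continuous_map_real_mult_left continuous_map_add
            continuous_qpmetric_compose_continuous_map[OF \<rho>]) auto
      then have "openin X ?U"
        unfolding continuous_map_upper_lower_semicontinuous_lt by blast
      moreover have "x \<in> ?U"
        using x \<epsilon> continuous_qpmetric_refl[OF \<rho> x] by simp
      moreover have "F y \<in> ball (F x) \<epsilon>" if "y \<in> ?U" for y
      proof -
        have y: "y \<in> topspace X" "b * (\<rho> x y + \<rho> y x) < \<epsilon> / 2" using that by auto
        have "0 \<le> b * \<rho> x y" "0 \<le> b * \<rho> y x"
          using b continuous_qpmetric_nonneg[OF \<rho>] x y(1) by (auto simp: A_def)
        then show ?thesis
          using F_mod[OF x y(1) b] F_mod[OF y(1) x b] y(2)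
          by (simp add: dist_real_def algebra_simps)
      qed
      ultimately show "\<exists>U. openin X U \<and> x \<in> U \<and> (\<forall>y\<in>U. F y \<in> Met_TC.mball (F x) \<epsilon>)"
        by (intro exI[of _ ?U]) auto
    qed
    then show "continuous_map X euclideanreal F" by simp
  qed
qed

section \<open>Histories and plans\<close>

lemma compact_space_C_top: "compact_space (C_top cbar)"
  by (simp add: compact_space_subtopology)

lemma finite_states: "finite (states T t :: ('s::finite) pstate set)"
  by (simp add: states_def)

lemma Phys_in_states: "t < T \<Longrightarrow> Phys s \<in> states T (Suc t)"
  by (simp add: states_def)

text \<open>At \<open>t = T\<close> the only next state is \<open>Star\<close>, which
  \<open>iota\<close> discards, so one formula covers ordinary steps and the final one.\<close>

lemma hists_Suc:
  assumes "t \<le> T"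
  shows "hists T cbar (Suc t) =
    (\<lambda>(h, c, s). iota T t h c s) ` (hists T cbar t \<times> {0..cbar} \<times> states T (Suc t))"
proof
  show "hists T cbar (Suc t) \<subseteq>
      (\<lambda>(h, c, s). iota T t h c s) ` (hists T cbar t \<times> {0..cbar} \<times> states T (Suc t))"
  proof (cases "t < T")
    case True
    then show ?thesis
      by (force simp: hists_def iota_def topspace_pullback_topology)
  next
    case False
    then show ?thesis
      using assms by (force simp: hists_def iota_def topspace_pullback_topology states_def)
  qed
qed (auto intro: iota_in_hists[OF assms])

text \<open>Continuity into a pullback topology is tested after applying the destructor. The
  composite is the identity for \<open>t < T\<close> and the projection forgetting
  \<open>Star\<close> at \<open>t = T\<close>.\<close>

lemma continuous_map_iota:
  fixes T :: nat
  assumes "t \<le> T"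
  shows "continuous_map (prod_topology (hist_top T cbar t)
      (prod_topology (C_top cbar) (discrete_topology (states T (Suc t)))))
    (hist_top T cbar (Suc t)) (\<lambda>(h, c, s). iota T t h c s)"
proof (cases "t < T")
  case True
  have eq: "(\<lambda>h. (h_prev h, h_con h, h_st h)) \<circ> (\<lambda>(h, c, s). iota T t h c s) = id"
    using True by (auto simp: iota_def)
  show ?thesis
    unfolding hist_top.simps if_P[OF True]
    by (rule continuous_map_pullback', unfold eq) (use True in \<open>auto simp: iota_def\<close>)
next
  case False
  have eq: "(\<lambda>h. (h_prev h, h_con h)) \<circ> (\<lambda>(h, c, s). iota T t h c s) = (\<lambda>p. (fst p, fst (snd p)))"
    using False by (auto simp: iota_def)
  have "continuous_map (prod_topology (hist_top T cbar t)
      (prod_topology (C_top cbar) (discrete_topology (states T (Suc t)))))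
      (prod_topology (hist_top T cbar t) (C_top cbar)) (\<lambda>p. (fst p, fst (snd p)))"
    by (intro continuous_map_pairedI continuous_map_fst
        continuous_map_compose[OF continuous_map_snd continuous_map_fst, unfolded o_def])
  then show ?thesis
    unfolding hist_top.simps if_not_P[OF False]
    by (intro continuous_map_pullback', unfold eq) (use False in \<open>auto simp: iota_def\<close>)
qed

text \<open>By induction, each history space is the continuous image under \<open>iota\<close> of a
  compact product.\<close>

lemma compact_space_hist_top:
  assumes "t \<le> Suc T"
  shows "compact_space (hist_top T cbar t :: ('s::finite) hist topology)"
  using assms
proof (induction t)
  case 0
  then show ?case by (simp add: compact_space_discrete_topology)
next
  case (Suc t)
  let ?K = "prod_topology (hist_top T cbar t :: 's hist topology)
      (prod_topology (C_top cbar) (discrete_topology (states T (Suc t) :: 's pstate set)))"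
  have "compact_space ?K"
    using Suc by (simp add: compact_space_prod_topology compact_space_C_top
        compact_space_discrete_topology finite_states)
  then have "compactin (hist_top T cbar (Suc t)) ((\<lambda>(h, c, s). iota T t h c s) ` topspace ?K)"
    using Suc.prems by (intro image_compactin[OF _ continuous_map_iota]) (auto simp: compact_space_def)
  moreover have "(\<lambda>(h, c, s). iota T t h c s) ` topspace ?K = topspace (hist_top T cbar (Suc t) :: 's hist topology)"
    using Suc.prems by (simp add: hists_Suc flip: hists_def del: hist_top.simps)
  ultimately show ?case by (simp add: compact_space_def)
qed

lemma states_nonempty: "states T t \<noteq> {}"
  by (simp add: states_def)

lemma hists_nonempty:
  assumes "0 \<le> cbar" "t \<le> Suc T"
  shows "hists T cbar t \<noteq> {}"
  using assms(2)
proof (induction t)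
  case 0
  then show ?case by (simp add: hists_def)
next
  case (Suc t)
  then show ?case using assms(1) by (simp add: hists_Suc states_nonempty)
qed

lemma phys_state_iota:
  assumes "t \<le> T" "s \<in> states T (Suc t)"
  shows "phys_state (iota T t h c s) = s"
  using assms by (auto simp: iota_def states_def split: if_splits)

lemma continuous_map_phys_state:
  assumes "t \<le> Suc T"
  shows "continuous_map (hist_top T cbar t) (discrete_topology (states T t)) phys_state"
proof (cases t)
  case 0
  then show ?thesis by (simp add: states_def)
next
  case (Suc t')
  show ?thesis
  proof (cases "t' < T")
    case True
    have "continuous_map (hist_top T cbar t) (discrete_topology (states T t))
        ((snd \<circ> snd) \<circ> (\<lambda>h. (h_prev h, h_con h, h_st h)))"
      unfolding Suc hist_top.simps if_P[OF True]
      by (intro continuous_map_pullback continuous_map_compose[OF continuous_map_snd continuous_map_snd])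
    then show ?thesis
      by (rule continuous_map_eq) (use Suc True in \<open>auto simp: topspace_pullback_topology\<close>)
  next
    case False
    then have "t = Suc T" using Suc assms by simp
    have "continuous_map (hist_top T cbar t) (discrete_topology (states T t)) (\<lambda>_. Star)"
      using \<open>t = Suc T\<close> by (simp add: states_def)
    then show ?thesis
      by (rule continuous_map_eq) (use \<open>t = Suc T\<close> in \<open>auto simp: topspace_pullback_topology\<close>)
  qed
qed

section \<open>The topology of plans\<close>

lemma plan_top_Suc:
  "t \<le> T \<Longrightarrow> plan_top T cbar t =
    pullback_topology {Plan c k |c k. True} (\<lambda>f. (p_con f, p_cont f))
      (prod_topology (C_top cbar) (product_topology (\<lambda>_. plan_top T cbar (Suc t)) UNIV))"
  by (simp add: plan_top_def Suc_diff_le)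

lemma continuous_map_p_con:
  assumes "t \<le> T"
  shows "continuous_map (plan_top T cbar t) (C_top cbar) p_con"
proof -
  have "continuous_map (plan_top T cbar t) (C_top cbar) (fst \<circ> (\<lambda>f. (p_con f, p_cont f)))"
    unfolding plan_top_Suc[OF assms] by (intro continuous_map_pullback continuous_map_fst)
  then show ?thesis by (simp add: o_def)
qed

lemma continuous_map_p_cont:
  assumes "t \<le> T"
  shows "continuous_map (plan_top T cbar t) (plan_top T cbar (Suc t)) (\<lambda>f. p_cont f s)"
proof -
  have "continuous_map (plan_top T cbar t) (plan_top T cbar (Suc t))
      (((\<lambda>k. k s) \<circ> snd) \<circ> (\<lambda>f. (p_con f, p_cont f)))"
    unfolding plan_top_Suc[OF assms]
    by (intro continuous_map_pullback continuous_map_compose[OF continuous_map_snd]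
        continuous_map_product_projection) simp
  then show ?thesis by (simp add: o_def)
qed

lemma compact_space_plan_top_aux:
  "compact_space (plan_top_aux cbar n :: ('s::finite) plan topology)"
proof (induction n)
  case 0
  then show ?case by (simp add: compact_space_discrete_topology)
next
  case (Suc n)
  let ?K = "prod_topology (C_top cbar) (product_topology (\<lambda>_::'s. plan_top_aux cbar n :: 's plan topology) UNIV)"
  have "compact_space ?K"
    using Suc by (simp add: compact_space_prod_topology compact_space_C_top compact_space_product_topology)
  moreover have "continuous_map ?K (plan_top_aux cbar (Suc n)) (\<lambda>(c, k). Plan c k)"
    by (auto intro!: continuous_map_pullback' simp: o_def case_prod_unfold)
  ultimately have "compactin (plan_top_aux cbar (Suc n)) ((\<lambda>(c, k). Plan c k) ` topspace ?K)"
    by (intro image_compactin[of ?K]) (auto simp: compact_space_def)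
  moreover have "(\<lambda>(c, k). Plan c k) ` topspace ?K =
      topspace (plan_top_aux cbar (Suc n) :: 's plan topology)"
    by (force simp: topspace_pullback_topology)
  ultimately show ?case by (simp add: compact_space_def)
qed

lemma compact_space_plan_top: "compact_space (plan_top T cbar t :: ('s::finite) plan topology)"
  by (simp add: plan_top_def compact_space_plan_top_aux)

lemma plans_nonempty:
  assumes "0 \<le> cbar"
  shows "(plans T cbar t :: 's plan set) \<noteq> {}"
proof -
  have "\<exists>f. f \<in> topspace (plan_top_aux cbar n :: 's plan topology)" for n
  proof (induction n)
    case (Suc n)
    then obtain f where "f \<in> topspace (plan_top_aux cbar n :: 's plan topology)" by blast
    then have "Plan 0 (\<lambda>_. f) \<in> topspace (plan_top_aux cbar (Suc n))"
      using assms by (simp add: topspace_pullback_topology PiE_iff)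
    then show ?case by blast
  qed simp
  then show ?thesis unfolding plans_def plan_top_def by blast
qed

lemma topspace_dec_top: "topspace (dec_top T cbar t) = decs T cbar t"
  by (simp add: dec_top_def decs_def hists_def plans_def)

lemma compact_space_dec_top:
  "t \<le> Suc T \<Longrightarrow> compact_space (dec_top T cbar t :: (('s::finite) hist \<times> 's plan) topology)"
  by (simp add: dec_top_def compact_space_prod_topology compact_space_hist_top compact_space_plan_top)

section \<open>The canonical state system\<close>

lemma indiff_iff_util_eq:
  assumes "compatible T cbar P U" "t \<le> T" "h \<in> hists T cbar t" "h' \<in> hists T cbar t"
    and "f \<in> plans T cbar t" "g \<in> plans T cbar t"
  shows "indiff P t (h, f) (h', g) \<longleftrightarrow> util U t h f = util U t h' g"
proof -
  have "util U t h f \<ge> util U t h' g \<longleftrightarrow> pref P t (h, f) (h', g)"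
       "util U t h' g \<ge> util U t h f \<longleftrightarrow> pref P t (h', g) (h, f)"
    using assms unfolding compatible_def by blast+
  then show ?thesis unfolding indiff_def by auto
qed

lemma odot_util_eq:
  assumes "compatible T cbar P U" "t \<le> T" "h \<in> hists T cbar t" "h' \<in> hists T cbar t"
    and "odot T cbar P U t h h'" "f \<in> plans T cbar t"
  shows "util U t h f = util U t h' f"
  using assms indiff_iff_util_eq[OF assms(1-4,6,6)] by (simp add: odot_unfold)

text \<open>Equivalent histories stay equivalent after the same consumption and state, so the
  utilities of the continuation plans agree state by state.\<close>

lemma odot_tilde_u_eq:
  fixes P :: "'s grand_pref" and U :: "'s util_sys"
  assumes "compatible T cbar P U" "t < T" "h \<in> hists T cbar t" "h' \<in> hists T cbar t"
    and "odot T cbar P U t h h'" "f \<in> plans T cbar t"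
  shows "tilde_u T U t h f = tilde_u T U t h' f"
proof
  fix s :: 's
  obtain c fp where f: "f = Plan c fp" "c \<in> {0..cbar}" "\<And>s. fp s \<in> plans T cbar (Suc t)"
    using assms(2,6) by (auto simp: plans_Plan conts_def)
  have s: "Phys s \<in> states T (Suc t)" using assms(2) by (rule Phys_in_states)
  have "odot T cbar P U (Suc t) (iota T t h c (Phys s)) (iota T t h' c (Phys s))"
    using assms(2,5) f(2) s by (simp add: odot_unfold)
  then show "tilde_u T U t h f s = tilde_u T U t h' f s"
    unfolding tilde_u_def f(1) plan.sel
    using assms(2-4) f(2,3) s by (intro odot_util_eq[OF assms(1)] iota_in_hists) auto
qed

lemma canon_proj_eq_iff:
  assumes "weak_order T cbar P" "t \<le> Suc T" "h \<in> hists T cbar t" "h' \<in> hists T cbar t"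
  shows "canon_proj T cbar P U t h = canon_proj T cbar P U t h' \<longleftrightarrow> odot T cbar P U t h h'"
proof
  assume "canon_proj T cbar P U t h = canon_proj T cbar P U t h'"
  moreover have "h' \<in> canon_proj T cbar P U t h'"
    using odot_refl[OF assms(1,4,2)] assms(4) by (simp add: canon_proj_def)
  ultimately show "odot T cbar P U t h h'" by (auto simp: canon_proj_def)
qed (rule canon_proj_eq[OF assms])

text \<open>Backward induction along the recursion of \<open>odot\<close>, starting from the
  difference of terminal utilities. The three clauses become three summands: a discrete distance of
  states, a supremum over plans of utility gaps, and a supremum over consumption and next state of
  the distance one stage later. A sum of nonnegative terms vanishes only if each term does.\<close>

lemma odot_qpmetric:
  fixes P :: "('s::finite) grand_pref" and U :: "'s util_sys"
  assumes "0 \<le> cbar" "utility_system T cbar U" "compatible T cbar P U" "t \<le> Suc T"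
  obtains d where "continuous_qpmetric (hist_top T cbar t) d"
    and "\<And>h h'. h \<in> hists T cbar t \<Longrightarrow> h' \<in> hists T cbar t \<Longrightarrow>
      d h h' = 0 \<longleftrightarrow> odot T cbar P U t h h'"
proof -
  have "\<exists>d. continuous_qpmetric (hist_top T cbar t) d \<and>
      (\<forall>h\<in>hists T cbar t. \<forall>h'\<in>hists T cbar t. d h h' = 0 \<longleftrightarrow> odot T cbar P U t h h')"
    using assms(4)
  proof (induction "Suc T - t" arbitrary: t)
    case 0
    then have [simp]: "t = Suc T" by simp
    have "continuous_map (hist_top T cbar t) euclideanreal (uterm U)"
      using assms(2) by (simp add: utility_system_def)
    from continuous_qpmetric_pullback[OF continuous_qpmetric_absdiff this]
    show ?case by (intro exI conjI) (auto simp: odot_final)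
  next
    case (Suc n)
    from Suc.hyps(2) have t: "t \<le> T" "n = Suc T - Suc t" by simp_all
    obtain d' where d': "continuous_qpmetric (hist_top T cbar (Suc t)) d'"
      "\<And>h h'. h \<in> hists T cbar (Suc t) \<Longrightarrow> h' \<in> hists T cbar (Suc t) \<Longrightarrow>
        d' h h' = 0 \<longleftrightarrow> odot T cbar P U (Suc t) h h'"
      using Suc.hyps(1)[OF t(2)] t(1) by auto
    let ?H = "hist_top T cbar t :: 's hist topology"
    let ?F = "plan_top T cbar t :: 's plan topology"
    let ?C = "prod_topology (C_top cbar) (discrete_topology (states T (Suc t) :: 's pstate set))"
    define d1 where "d1 = (\<lambda>h h' :: 's hist. if phys_state h = phys_state h' then 0 else (1::real))"
    \<comment> \<open>The unreduced abstractions in \<open>d2\<close> and \<open>d3\<close> keep the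
      shape \<open>e (x, k)\<close> in which \<open>continuous_qpmetric_SUP\<close> is
      stated.\<close>
    define d2 where "d2 = (\<lambda>h h'. SUP f\<in>topspace ?F.
        \<bar>(\<lambda>(h, f). util U t h f) (h, f) - (\<lambda>(h, f). util U t h f) (h', f)\<bar>)"
    define d3 where "d3 = (\<lambda>h h'. SUP k\<in>topspace ?C.
        d' ((\<lambda>(h, c, s). iota T t h c s) (h, k)) ((\<lambda>(h, c, s). iota T t h c s) (h', k)))"
    have cF: "topspace ?F \<noteq> {}" using plans_nonempty[OF assms(1)] by (simp add: plans_def)
    have cC: "compact_space ?C" "topspace ?C \<noteq> {}"
      using assms(1) by (simp_all add: compact_space_prod_topology compact_space_C_top
          compact_space_discrete_topology finite_states states_nonempty)
    have u: "continuous_map (prod_topology ?H ?F) euclideanreal (\<lambda>(h, f). util U t h f)"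
      using assms(2) t(1) by (simp add: utility_system_def dec_top_def)
    have q1: "continuous_qpmetric ?H d1"
      unfolding d1_def
      by (rule continuous_qpmetric_pullback[OF continuous_qpmetric_discrete
            continuous_map_phys_state]) (use t in simp)
    note q2 = continuous_qpmetric_SUP[OF compact_space_plan_top cF continuous_qpmetric_absdiff u,
        folded d2_def]
    note q3 = continuous_qpmetric_SUP[OF cC d'(1) continuous_map_iota[OF t(1)], folded d3_def]
    show ?case
    proof (intro exI conjI ballI)
      show "continuous_qpmetric ?H (\<lambda>h h'. d1 h h' + d2 h h' + d3 h h')"
        by (intro continuous_qpmetric_add q1 q2 q3)
      fix h h' :: "'s hist"
      assume h: "h \<in> hists T cbar t" "h' \<in> hists T cbar t"
      then have hh: "h \<in> topspace ?H" "h' \<in> topspace ?H" by (simp_all add: hists_def)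
      have "d1 h h' = 0 \<longleftrightarrow> phys_state h = phys_state h'" by (simp add: d1_def)
      moreover have "d2 h h' = 0 \<longleftrightarrow> (\<forall>f\<in>plans T cbar t. indiff P t (h, f) (h', f))"
        using q2(2)[OF hh] indiff_iff_util_eq[OF assms(3) t(1) h] by (simp add: plans_def d2_def)
      moreover have "d3 h h' = 0 \<longleftrightarrow> (\<forall>c\<in>{0..cbar}. \<forall>s\<in>states T (Suc t).
          odot T cbar P U (Suc t) (iota T t h c s) (iota T t h' c s))"
        using q3(2)[OF hh] d'(2) iota_in_hists[OF t(1) h(1)] iota_in_hists[OF t(1) h(2)]
        by (auto simp: d3_def)
      ultimately show "d1 h h' + d2 h h' + d3 h h' = 0 \<longleftrightarrow> odot T cbar P U t h h'"
        using continuous_qpmetric_nonneg[OF q1 hh] continuous_qpmetric_nonneg[OF q2(1) hh]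
          continuous_qpmetric_nonneg[OF q3(1) hh]
        unfolding odot_unfold[OF t(1)] by (metis add_nonneg_eq_0_iff add_nonneg_nonneg)
    qed
  qed
  then show ?thesis using that by blast
qed

section \<open>The canonical quotients\<close>

lemma pa_top_canonical:
  "pa_top (canonical_sys T cbar P U) t = quotient_top (hist_top T cbar t) (canon_proj T cbar P U t)"
  by (simp add: canonical_sys_def)

lemma quotient_map_canon_proj:
  "quotient_map (hist_top T cbar t) (pa_top (canonical_sys T cbar P U) t) (canon_proj T cbar P U t)"
  by (simp add: pa_top_canonical quotient_map_quotient_top)

lemma topspace_canonical:
  "topspace (pa_top (canonical_sys T cbar P U) t) = canon_proj T cbar P U t ` hists T cbar t"
  by (simp add: pa_top_canonical topspace_quotient_top hists_def)

text \<open>The product of a quotient map with the identity of a locally compact Hausdorff space is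
  again a quotient map. Continuity of the step map and of the aggregators can therefore be checked
  on histories.\<close>

lemma continuous_map_from_quotient_prod:
  assumes "quotient_map X Y p" "locally_compact_space Z" "Hausdorff_space Z"
    and g: "continuous_map (prod_topology X Z) W g"
    and eq: "\<And>x z. x \<in> topspace X \<Longrightarrow> z \<in> topspace Z \<Longrightarrow> G (p x, z) = g (x, z)"
  shows "continuous_map (prod_topology Y Z) W G"
proof (rule continuous_compose_quotient_map[OF quotient_map_prod_left])
  show "continuous_map (prod_topology X Z) W (G \<circ> (\<lambda>(x, z). (p x, z)))"
    by (rule continuous_map_eq[OF g]) (use eq in auto)
qed (use assms in auto)

text \<open>Compactness is inherited as an image of the history space and metrizability comes from
  the distance with zero set \<open>odot\<close>. The state and step maps are continuous because
  their lifts to histories, \<open>phys_state\<close> and \<open>iota\<close> followed by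
  projection, are.\<close>

lemma pa_state_system_canonical:
  fixes P :: "('s::finite) grand_pref" and U :: "'s util_sys"
  assumes "0 \<le> cbar" "utility_system T cbar U" "compatible T cbar P U" "weak_order T cbar P"
  shows "pa_state_system T cbar (canonical_sys T cbar P U)"
  unfolding pa_state_system_def
proof (intro conjI allI impI ballI)
  let ?X = "canonical_sys T cbar P U"
  fix t assume t: "t \<le> Suc T"
  show "topspace (pa_top ?X t) \<noteq> {}"
    using hists_nonempty[OF assms(1) t] by (simp add: topspace_canonical)
  show "compact_space (pa_top ?X t)"
    unfolding compact_space_def topspace_canonical hists_def
    using compact_space_hist_top[OF t] unfolding compact_space_def
    by (rule image_compactin[OF _ quotient_imp_continuous_map[OF quotient_map_canon_proj]])
  obtain d where "continuous_qpmetric (hist_top T cbar t) d"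
    and "\<And>h h'. h \<in> hists T cbar t \<Longrightarrow> h' \<in> hists T cbar t \<Longrightarrow>
      d h h' = 0 \<longleftrightarrow> odot T cbar P U t h h'"
    using odot_qpmetric[OF assms(1-3) t] by blast
  then show "metrizable_space (pa_top ?X t)"
    by (intro metrizable_quotient_of_qpmetric[OF compact_space_hist_top[OF t] _ quotient_map_canon_proj])
      (auto simp: canon_proj_eq_iff[OF assms(4) t] simp flip: hists_def)
  show "continuous_map (pa_top ?X t) (discrete_topology (states T t)) (pa_st ?X t)"
  proof (rule continuous_compose_quotient_map[OF quotient_map_canon_proj])
    show "continuous_map (hist_top T cbar t) (discrete_topology (states T t))
        (pa_st ?X t \<circ> canon_proj T cbar P U t)"
      by (rule continuous_map_eq[OF continuous_map_phys_state[OF t]])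
        (simp add: canon_st_proj[OF assms(4) t] flip: hists_def)
  qed
next
  let ?X = "canonical_sys T cbar P U"
  fix t assume t: "t \<le> T"
  let ?C = "prod_topology (C_top cbar) (discrete_topology (states T (Suc t) :: 's pstate set))"
  show "continuous_map (prod_topology (pa_top ?X t) ?C) (pa_top ?X (Suc t))
      (\<lambda>(x, c, s). pa_step ?X t x c s)"
  proof (rule continuous_map_from_quotient_prod[OF quotient_map_canon_proj])
    show "locally_compact_space ?C"
      by (intro compact_imp_locally_compact_space) (simp add: compact_space_prod_topology
          compact_space_C_top compact_space_discrete_topology finite_states)
    show "Hausdorff_space ?C"
      by (simp add: Hausdorff_space_prod_topology Hausdorff_space_subtopology)
    show "continuous_map (prod_topology (hist_top T cbar t) ?C) (pa_top ?X (Suc t))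
        (canon_proj T cbar P U (Suc t) \<circ> (\<lambda>(h, c, s). iota T t h c s))"
      by (intro continuous_map_compose[OF continuous_map_iota[OF t]]
          quotient_imp_continuous_map quotient_map_canon_proj)
  qed (use canon_step_proj[OF assms(4) t] in \<open>auto simp flip: hists_def\<close>)
  fix x c and s :: "'s pstate"
  assume "x \<in> topspace (pa_top ?X t)" and c: "c \<in> {0..cbar}" and s: "s \<in> states T (Suc t)"
  then obtain h where "x = canon_proj T cbar P U t h" and h: "h \<in> hists T cbar t"
    by (auto simp: topspace_canonical)
  then show "pa_st ?X (Suc t) (pa_step ?X t x c s) = s"
    using t c s by (simp add: canon_step_proj[OF assms(4)] canon_st_proj[OF assms(4)]
        iota_in_hists phys_state_iota)
qed

section \<open>Aggregators\<close>

lemma plans_sel: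
  assumes "t \<le> T" "f \<in> plans T cbar t"
  shows "p_con f \<in> {0..cbar}" "p_cont f \<in> conts T cbar (Suc t)" "Plan (p_con f) (p_cont f) = f"
  using assms by (auto simp: plans_Plan)

lemma tilde_u_in_Lambda:
  assumes "t \<le> T" "f \<in> plans T cbar t"
  shows "tilde_u T U t h f \<in> Lambda T cbar U t h"
proof -
  have "tilde_u T U t h (Plan (p_con f) (p_cont f)) \<in> Lambda T cbar U t h"
    using plans_sel(1,2)[OF assms] by (auto simp: Lambda_def Lambda_at_def)
  then show ?thesis using plans_sel(3)[OF assms] by simp
qed

section \<open>Continuity and order on utility vectors\<close>

lemma continuous_map_into_fun:
  fixes g :: "'a \<Rightarrow> 'b \<Rightarrow> real"
  assumes "\<And>i. continuous_map X euclideanreal (\<lambda>x. g x i)"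
  shows "continuous_map X euclidean g"
  using assms unfolding euclidean_product_topology[symmetric] continuous_map_componentwise_UNIV
  by blast

lemma continuous_map_fun_component:
  "continuous_map euclidean euclideanreal (\<lambda>u :: 'b \<Rightarrow> real. u i)"
  using continuous_map_product_projection[of i UNIV "\<lambda>_::'b. euclideanreal"]
  by (simp add: euclidean_product_topology)

lemma continuous_map_tilde_u:
  fixes U :: "('s::finite) util_sys"
  assumes "utility_system T cbar U" "t < T"
  shows "continuous_map (dec_top T cbar t) euclidean (\<lambda>p. tilde_u T U t (fst p) (snd p))"
proof (rule continuous_map_into_fun)
  fix s :: 's
  have fst: "continuous_map (dec_top T cbar t) (hist_top T cbar t) fst"
    and snd: "continuous_map (dec_top T cbar t) (plan_top T cbar t) snd"
    unfolding dec_top_def by (intro continuous_map_fst continuous_map_snd)+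
  have t: "t \<le> T" "Suc t \<le> T" using assms(2) by simp_all
  have "continuous_map (dec_top T cbar t) (prod_topology (hist_top T cbar t)
      (prod_topology (C_top cbar) (discrete_topology (states T (Suc t)))))
      (\<lambda>p. (fst p, p_con (snd p), Phys s))"
    using assms(2)
    by (intro continuous_map_pairedI fst
        continuous_map_compose[OF snd continuous_map_p_con, unfolded o_def])
      (simp_all add: Phys_in_states)
  then have i: "continuous_map (dec_top T cbar t) (hist_top T cbar (Suc t))
      (\<lambda>p. iota T t (fst p) (p_con (snd p)) (Phys s))"
    using continuous_map_compose[OF _ continuous_map_iota[OF t(1)]] by (fastforce simp: o_def)
  have c: "continuous_map (dec_top T cbar t) (plan_top T cbar (Suc t)) (\<lambda>p. p_cont (snd p) s)"
    by (rule continuous_map_compose[OF snd continuous_map_p_cont[OF t(1)], unfolded o_def])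
  have "continuous_map (prod_topology (hist_top T cbar (Suc t)) (plan_top T cbar (Suc t)))
      euclideanreal (\<lambda>(h, f). util U (Suc t) h f)"
    using assms(1) t(2) unfolding utility_system_def dec_top_def by blast
  from continuous_map_compose[OF continuous_map_pairedI[OF i c] this]
  show "continuous_map (dec_top T cbar t) euclideanreal (\<lambda>p. tilde_u T U t (fst p) (snd p) s)"
    by (simp add: tilde_u_def o_def)
qed

lemma continuous_qpmetric_fun:
  "continuous_qpmetric euclidean (\<lambda>u v :: ('s::finite) \<Rightarrow> real. \<Sum>s\<in>UNIV. max 0 (u s - v s))"
  by (intro continuous_qpmetric_sum continuous_qpmetric_pullback[OF continuous_qpmetric_posdiff]
      continuous_map_fun_component) simp

lemma sum_posdiff_eq_0_iff:
  "(\<Sum>s\<in>UNIV. max 0 (u s - v s)) = 0 \<longleftrightarrow> u \<le> (v :: ('s::finite) \<Rightarrow> real)"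
proof -
  have "max 0 (u s - v s) = 0 \<longleftrightarrow> u s \<le> v s" for s by (simp add: max_def)
  then show ?thesis by (simp add: sum_nonneg_eq_0_iff le_fun_def)
qed

lemma continuous_map_Max_range:
  "continuous_map euclidean euclideanreal (\<lambda>u :: ('s::finite) \<Rightarrow> real. Max (range u))"
proof -
  have "continuous_map euclidean euclideanreal (\<lambda>u :: 's \<Rightarrow> real. SUP i\<in>UNIV. u i)"
    by (intro continuous_map_Sup continuous_map_fun_component) simp
  then show ?thesis by (simp add: cSup_eq_Max)
qed

lemma continuous_map_Min_range:
  "continuous_map euclidean euclideanreal (\<lambda>u :: ('s::finite) \<Rightarrow> real. Min (range u))"
proof -
  have "continuous_map euclidean euclideanreal (\<lambda>u :: 's \<Rightarrow> real. INF i\<in>UNIV. u i)"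
    by (intro continuous_map_Inf continuous_map_fun_component) simp
  then show ?thesis by (simp add: cInf_eq_Min)
qed

lemma Max_range_mono: "u \<le> v \<Longrightarrow> Max (range u) \<le> Max (range (v :: ('s::finite) \<Rightarrow> real))"
  by (rule Max.boundedI) (auto simp: le_fun_def intro: order_trans[OF _ Max_ge])

lemma Min_range_mono: "u \<le> v \<Longrightarrow> Min (range u) \<le> Min (range (v :: ('s::finite) \<Rightarrow> real))"
  by (rule Min.boundedI) (auto simp: le_fun_def intro: order_trans[OF Min_le])

lemma locally_compact_space_fun:
  "locally_compact_space (euclidean :: (('s::finite) \<Rightarrow> real) topology)"
  unfolding euclidean_product_topology[symmetric] locally_compact_space_product_topology
  by (simp add: locally_compact_space_euclidean)

lemma Hausdorff_space_fun: "Hausdorff_space (euclidean :: ('s \<Rightarrow> real) topology)"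
  unfolding euclidean_product_topology[symmetric] Hausdorff_space_product_topology by simp

text \<open>One stage of the recursion, still formulated on histories instead of classes. The two
  clauses about \<open>odot\<close> are what allows \<open>W\<close> and \<open>M\<close> to descend
  to the quotient.\<close>

definition stage_aggregators ::
  "nat \<Rightarrow> real \<Rightarrow> ('s::finite) grand_pref \<Rightarrow> 's util_sys \<Rightarrow> nat \<Rightarrow>
    ('s hist \<Rightarrow> real \<Rightarrow> real \<Rightarrow> real) \<Rightarrow> ('s hist \<Rightarrow> ('s \<Rightarrow> real) \<Rightarrow> real) \<Rightarrow> bool" where
  "stage_aggregators T cbar P U t W M \<longleftrightarrow>
     continuous_map (prod_topology (hist_top T cbar t) (prod_topology (C_top cbar) euclideanreal))
       euclideanreal (\<lambda>(h, c, v). W h c v) \<and>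
     (\<forall>h\<in>hists T cbar t. \<forall>c\<in>{0..cbar}. mono (W h c)) \<and>
     (\<forall>h\<in>hists T cbar t. \<forall>h'\<in>hists T cbar t. odot T cbar P U t h h' \<longrightarrow>
       (\<forall>c\<in>{0..cbar}. \<forall>v. W h c v = W h' c v)) \<and>
     continuous_map (prod_topology (hist_top T cbar t) euclidean) euclideanreal (\<lambda>(h, u). M h u) \<and>
     (\<forall>h\<in>hists T cbar t. mono (M h)) \<and>
     (\<forall>h v. M h (\<lambda>_. v) = v) \<and>
     (\<forall>h\<in>hists T cbar t. \<forall>h'\<in>hists T cbar t. odot T cbar P U t h h' \<longrightarrow> M h = M h') \<and>
     (\<forall>h\<in>hists T cbar t. \<forall>f\<in>plans T cbar t.
       util U t h f = W h (p_con f) (M h (tilde_u T U t h f)))"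

text \<open>Two uses of \<open>monotone_extension\<close>, both with the compact space of decisions
  as parameter space. \<open>M\<close> comes from extending \<open>M0\<close> along history and
  utility vector, \<open>W\<close> from extending \<open>util\<close> along history, consumption and
  certainty equivalent.\<close>

lemma stage_aggregators_exist:
  fixes P :: "('s::finite) grand_pref" and U :: "'s util_sys"
  assumes "0 \<le> cbar" "utility_system T cbar U" "compatible T cbar P U"
    "ce_richness T cbar P U" "t < T"
  shows "\<exists>W M. stage_aggregators T cbar P U t W M"
proof -
  let ?H = "hist_top T cbar t :: 's hist topology"
  let ?D = "dec_top T cbar t :: ('s hist \<times> 's plan) topology"
  let ?u = "tilde_u T U t"
  have t: "t \<le> T" using assms(5) by simp
  obtain M0 where
    M0_cont: "continuous_map (subtopology (prod_topology ?H euclidean) (DM T cbar U t))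
          euclideanreal (\<lambda>(h, u). M0 h u)"
    and M0: "\<forall>h\<in>hists T cbar t.
           (\<forall>c\<in>{0..cbar}. \<forall>fp\<in>conts T cbar (Suc t). \<forall>gp\<in>conts T cbar (Suc t).
              cond_pref P t h (Plan c fp) (Plan c gp) \<longleftrightarrow>
              M0 h (?u h (Plan c fp)) \<ge> M0 h (?u h (Plan c gp))) \<and>
           (\<forall>v. (\<lambda>_. v) \<in> Lambda T cbar U t h \<longrightarrow> M0 h (\<lambda>_. v) = v) \<and>
           (\<forall>u\<in>Lambda T cbar U t h. Min (range u) \<le> M0 h u \<and> M0 h u \<le> Max (range u)) \<and>
           (\<forall>c\<in>{0..cbar}. \<forall>fp\<in>conts T cbar (Suc t). \<exists>gp\<in>conts T cbar (Suc t).
              ?u h (Plan c gp) = (\<lambda>_. M0 h (?u h (Plan c fp)))) \<and>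
           (\<forall>u\<in>Lambda T cbar U t h. \<forall>v\<in>Lambda T cbar U t h. u \<le> v \<longrightarrow> M0 h u \<le> M0 h v)"
    using mp[OF spec[OF assms(4)[unfolded ce_richness_def]] assms(5)]
    by (elim exE conjE) (rule that)
  note M0_1 = bspec[OF M0, THEN conjunct1]
    and M0_2 = bspec[OF M0, THEN conjunct2, THEN conjunct1]
    and M0_3 = bspec[OF M0, THEN conjunct2, THEN conjunct2, THEN conjunct1]
    and M0_4 = bspec[OF M0, THEN conjunct2, THEN conjunct2, THEN conjunct2, THEN conjunct1]
    and M0_5 = bspec[OF M0, THEN conjunct2, THEN conjunct2, THEN conjunct2, THEN conjunct2]
  have M0_const: "M0 h (\<lambda>_. v) = v" if "h \<in> hists T cbar t" "(\<lambda>_. v) \<in> Lambda T cbar U t h" for h v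
    using M0_2 that by blast
  have M0_bounds: "Min (range u) \<le> M0 h u" "M0 h u \<le> Max (range u)"
    if "h \<in> hists T cbar t" "u \<in> Lambda T cbar U t h" for h u
    using M0_3 that by blast+
  have M0_mono: "M0 h u \<le> M0 h v"
    if "h \<in> hists T cbar t" "u \<in> Lambda T cbar U t h" "v \<in> Lambda T cbar U t h" "u \<le> v" for h u v
    using M0_5 that by blast
  \<comment> \<open>At a fixed history and fixed consumption, \<open>util\<close> and
    \<open>M0\<close> order plans alike: richness links \<open>M0\<close> to the preference and
    compatibility links the preference to \<open>util\<close>.\<close>
  have M0_util: "util U t h f \<ge> util U t h g \<longleftrightarrow> M0 h (?u h f) \<ge> M0 h (?u h g)"
    if "h \<in> hists T cbar t" "f \<in> plans T cbar t" "g \<in> plans T cbar t" "p_con f = p_con g" for h f g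
  proof -
    have "cond_pref P t h f g \<longleftrightarrow> M0 h (?u h f) \<ge> M0 h (?u h g)"
      using bspec[OF bspec[OF bspec[OF M0_1[OF that(1)] plans_sel(1)[OF t that(2)]]
            plans_sel(2)[OF t that(2)]] plans_sel(2)[OF t that(3)]]
        plans_sel(3)[OF t that(2)] plans_sel(3)[OF t that(3)] that(4) by simp
    moreover have "util U t h f \<ge> util U t h g \<longleftrightarrow> pref P t (h, f) (h, g)"
      using assms(3) t that unfolding compatible_def by blast
    ultimately show ?thesis by (simp add: cond_pref_def)
  qed
  have M0_ce: "\<exists>g\<in>plans T cbar t. p_con g = p_con f \<and> ?u h g = (\<lambda>_. M0 h (?u h f))"
    if h: "h \<in> hists T cbar t" and f: "f \<in> plans T cbar t" for h f
  proof -
    obtain gp where "gp \<in> conts T cbar (Suc t)"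
      "?u h (Plan (p_con f) gp) = (\<lambda>_. M0 h (?u h (Plan (p_con f) (p_cont f))))"
      using bspec[OF bspec[OF M0_4[OF h] plans_sel(1)[OF t f]] plans_sel(2)[OF t f]]
      by blast
    moreover have "Plan (p_con f) gp \<in> plans T cbar t"
      using calculation(1) plans_sel(1)[OF t f] by (simp add: plans_Plan[OF t])
    ultimately show ?thesis using plans_sel(3)[OF t f] by (metis plan.sel(1))
  qed
  have uL: "?u h f \<in> Lambda T cbar U t h" if "f \<in> plans T cbar t" for h f
    by (rule tilde_u_in_Lambda[OF t that])
  \<comment> \<open>The certainty equivalent of \<open>f\<close> is a constant act reached by the same consumption, and
    equivalent histories agree on its utility and on that of \<open>f\<close>.\<close>
  have M0_odot: "M0 h' (?u h f) = M0 h (?u h f)"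
    if h: "h \<in> hists T cbar t" "h' \<in> hists T cbar t" and o: "odot T cbar P U t h h'"
      and f: "f \<in> plans T cbar t" for h h' f
  proof -
    define v where "v = M0 h (?u h f)"
    obtain g where g: "g \<in> plans T cbar t" "p_con g = p_con f" "?u h g = (\<lambda>_. v)"
      using M0_ce[OF h(1) f] unfolding v_def by blast
    have L: "(\<lambda>_. v) \<in> Lambda T cbar U t h" using uL[OF g(1), of h] g(3) by simp
    have "util U t h f = util U t h g"
      using M0_util[OF h(1) f g(1)] M0_util[OF h(1) g(1) f] g(2,3) M0_const[OF h(1) L]
      by (simp add: v_def)
    then have "util U t h' f = util U t h' g"
      using odot_util_eq[OF assms(3) t h o] f g(1) by simp
    then have "M0 h' (?u h' f) = M0 h' (?u h' g)"
      using M0_util[OF h(2) f g(1)] M0_util[OF h(2) g(1) f] g(2) by simp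
    moreover have "?u h' f = ?u h f" "?u h' g = ?u h g"
      using odot_tilde_u_eq[OF assms(3,5) h o] f g(1) by simp_all
    moreover have "M0 h' (\<lambda>_. v) = v"
      using M0_const[OF h(2), of v] uL[OF g(1), of h'] \<open>?u h' g = ?u h g\<close> g(3) by simp
    ultimately show ?thesis using g(3) by (simp add: v_def)
  qed
  obtain d where d: "continuous_qpmetric ?H d"
    and d0: "\<And>h h'. h \<in> hists T cbar t \<Longrightarrow> h' \<in> hists T cbar t \<Longrightarrow>
      d h h' = 0 \<longleftrightarrow> odot T cbar P U t h h'"
    using odot_qpmetric[OF assms(1-3), of t] t by auto
  have d_refl: "d h h = 0" and d_nonneg: "h' \<in> hists T cbar t \<Longrightarrow> 0 \<le> d h h'"
    if "h \<in> hists T cbar t" for h h'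
    using continuous_qpmetric_refl[OF d] continuous_qpmetric_nonneg[OF d] that by (auto simp: hists_def)
  have K: "compact_space ?D" using t by (intro compact_space_dec_top) simp
  have fst: "continuous_map ?D ?H fst" and snd: "continuous_map ?D (plan_top T cbar t) snd"
    unfolding dec_top_def by (intro continuous_map_fst continuous_map_snd)+
  note u_cont = continuous_map_tilde_u[OF assms(2,5)]
  have "continuous_map ?D (subtopology (prod_topology ?H euclidean) (DM T cbar U t))
      (\<lambda>p. (fst p, ?u (fst p) (snd p)))"
    using uL by (intro continuous_map_into_subtopology continuous_map_pairedI fst u_cont)
      (auto simp: topspace_dec_top decs_def DM_def)
  from continuous_map_compose[OF this M0_cont]
  have m_cont: "continuous_map ?D euclideanreal (\<lambda>p. M0 (fst p) (?u (fst p) (snd p)))"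
    by (simp add: o_def)

  let ?\<rho> = "\<lambda>p q. d (fst p) (fst q) + (\<Sum>s\<in>UNIV. max 0 (snd p s - snd q s))"
  have \<rho>: "continuous_qpmetric (prod_topology ?H (euclidean :: ('s \<Rightarrow> real) topology)) ?\<rho>"
    by (intro continuous_qpmetric_add continuous_qpmetric_pullback[OF d continuous_map_fst]
        continuous_qpmetric_pullback[OF continuous_qpmetric_fun continuous_map_snd])
  have \<rho>0: "?\<rho> p q = 0 \<longleftrightarrow> odot T cbar P U t (fst p) (fst q) \<and> snd p \<le> snd q"
    if "fst p \<in> hists T cbar t" "fst q \<in> hists T cbar t" for p q :: "'s hist \<times> ('s \<Rightarrow> real)"
  proof -
    have "0 \<le> (\<Sum>s\<in>UNIV. max 0 (snd p s - snd q s))" by (intro sum_nonneg) simp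
    then show ?thesis
      using add_nonneg_eq_0_iff[OF d_nonneg[OF that]] d0[OF that] sum_posdiff_eq_0_iff by metis
  qed
  obtain F where F_cont: "continuous_map (prod_topology ?H euclidean) euclideanreal F"
    and F_mono: "\<And>p q. p \<in> topspace (prod_topology ?H euclidean) \<Longrightarrow>
      q \<in> topspace (prod_topology ?H euclidean) \<Longrightarrow> ?\<rho> p q = 0 \<Longrightarrow> F p \<le> F q"
    and F_ext: "\<And>p. p \<in> topspace ?D \<Longrightarrow> F (fst p, ?u (fst p) (snd p)) = M0 (fst p) (?u (fst p) (snd p))"
  proof (rule monotone_extension[OF K \<rho> continuous_map_pairedI[OF fst u_cont] m_cont])
    fix p q assume "p \<in> topspace ?D" "q \<in> topspace ?D"
      and z: "?\<rho> (fst p, ?u (fst p) (snd p)) (fst q, ?u (fst q) (snd q)) = 0"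
    then obtain h f h' g where pq: "p = (h, f)" "q = (h', g)"
      and h: "h \<in> hists T cbar t" "h' \<in> hists T cbar t" and f: "f \<in> plans T cbar t" "g \<in> plans T cbar t"
      by (auto simp: topspace_dec_top decs_def)
    have o: "odot T cbar P U t h h'" and le: "?u h f \<le> ?u h' g"
      using z \<rho>0[of "(h, ?u h f)" "(h', ?u h' g)"] h by (simp_all add: pq)
    \<comment> \<open>Monotonicity of \<open>M0\<close> is only available within one history. The
      vector of \<open>g\<close> is the same at \<open>h\<close>, so the comparison is made there
      and then carried to \<open>h'\<close> by \<open>M0_odot\<close>.\<close>
    have "?u h g = ?u h' g" by (rule odot_tilde_u_eq[OF assms(3,5) h o f(2)])
    then have "M0 h (?u h f) \<le> M0 h' (?u h' g)"
      using M0_mono[OF h(1) uL[OF f(1)] uL[OF f(2)]] le M0_odot[OF h o f(2)] by simp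
    then show "M0 (fst p) (?u (fst p) (snd p)) \<le> M0 (fst q) (?u (fst q) (snd q))"
      by (simp add: pq)
  qed blast
  \<comment> \<open>Clamping between the extremes of \<open>u\<close> normalises the extension at constants.\<close>
  define M where "M = (\<lambda>h u. max (Min (range u)) (min (F (h, u)) (Max (range u))))"
  have F_le: "F (h, u) \<le> F (h', v)"
    if "h \<in> hists T cbar t" "h' \<in> hists T cbar t" "odot T cbar P U t h h'" "u \<le> v" for h h' u v
    using F_mono[of "(h, u)" "(h', v)"] \<rho>0[of "(h, u)" "(h', v)"] that by (simp add: hists_def)
  have odot_self: "odot T cbar P U t h h" if "h \<in> hists T cbar t" for h
    using d0[OF that that] d_refl[OF that] by simp
  \<comment> \<open>On attainable vectors clamping changes nothing, since richness places
    \<open>M0\<close> between the extremes of the vector.\<close>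
  have M_ext: "M h (?u h f) = M0 h (?u h f)" if "h \<in> hists T cbar t" "f \<in> plans T cbar t" for h f
    using F_ext[of "(h, f)"] M0_bounds[OF that(1) uL[OF that(2)]] that
    by (simp add: M_def topspace_dec_top decs_def)

  let ?Y = "prod_topology ?H (prod_topology (C_top cbar) euclideanreal)"
  \<comment> \<open>Consumption enters through an absolute difference, so that only plans with equal
    consumption are compared, as \<open>M0_util\<close> requires; the order is imposed on the last
    coordinate alone.\<close>
  let ?\<tau> = "\<lambda>p q. d (fst p) (fst q) + (\<bar>fst (snd p) - fst (snd q)\<bar> + max 0 (snd (snd p) - snd (snd q)))"
  have \<tau>: "continuous_qpmetric ?Y ?\<tau>"
    by (intro continuous_qpmetric_add continuous_qpmetric_pullback[OF d continuous_map_fst]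
        continuous_qpmetric_pullback[OF continuous_qpmetric_absdiff]
        continuous_qpmetric_pullback[OF continuous_qpmetric_posdiff]
        continuous_map_compose[OF continuous_map_snd continuous_map_snd, unfolded o_def]
        continuous_map_into_fulltopology[OF
          continuous_map_compose[OF continuous_map_snd continuous_map_fst, unfolded o_def]])
  have \<tau>0: "?\<tau> p q = 0 \<longleftrightarrow> odot T cbar P U t (fst p) (fst q) \<and> fst (snd p) = fst (snd q) \<and>
      snd (snd p) \<le> snd (snd q)"
    if "fst p \<in> hists T cbar t" "fst q \<in> hists T cbar t" for p q :: "'s hist \<times> real \<times> real"
    using d_nonneg[OF that] d0[OF that] by (subst add_nonneg_eq_0_iff) (auto simp: max_def)
  have e_cont: "continuous_map ?D ?Y (\<lambda>p. (fst p, p_con (snd p), M0 (fst p) (?u (fst p) (snd p))))"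
    by (intro continuous_map_pairedI fst m_cont
        continuous_map_compose[OF snd continuous_map_p_con[OF t], unfolded o_def])
  have util_cont: "continuous_map ?D euclideanreal (\<lambda>p. util U t (fst p) (snd p))"
    using assms(2) t unfolding utility_system_def case_prod_unfold by blast
  obtain G where G_cont: "continuous_map ?Y euclideanreal G"
    and G_mono: "\<And>p q. p \<in> topspace ?Y \<Longrightarrow> q \<in> topspace ?Y \<Longrightarrow> ?\<tau> p q = 0 \<Longrightarrow> G p \<le> G q"
    and G_ext: "\<And>p. p \<in> topspace ?D \<Longrightarrow>
      G (fst p, p_con (snd p), M0 (fst p) (?u (fst p) (snd p))) = util U t (fst p) (snd p)"
  proof (rule monotone_extension[OF K \<tau> e_cont util_cont])
    fix p q assume "p \<in> topspace ?D" "q \<in> topspace ?D"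
      and z: "?\<tau> (fst p, p_con (snd p), M0 (fst p) (?u (fst p) (snd p)))
        (fst q, p_con (snd q), M0 (fst q) (?u (fst q) (snd q))) = 0"
    then obtain h f h' g where pq: "p = (h, f)" "q = (h', g)"
      and h: "h \<in> hists T cbar t" "h' \<in> hists T cbar t" and f: "f \<in> plans T cbar t" "g \<in> plans T cbar t"
      by (auto simp: topspace_dec_top decs_def)
    have o: "odot T cbar P U t h h'" and c: "p_con f = p_con g"
      and le: "M0 h (?u h f) \<le> M0 h' (?u h' g)"
      using z \<tau>0[of "(h, p_con f, M0 h (?u h f))" "(h', p_con g, M0 h' (?u h' g))"] h
      by (simp_all add: pq)
    \<comment> \<open>The same transport as for \<open>M0\<close>: the plans \<open>f\<close> and
      \<open>g\<close> are compared at \<open>h\<close>, where \<open>M0_util\<close> applies, and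
      \<open>odot_util_eq\<close> moves the utility of \<open>g\<close> to
      \<open>h'\<close>.\<close>
    have "?u h g = ?u h' g" by (rule odot_tilde_u_eq[OF assms(3,5) h o f(2)])
    then have "util U t h f \<le> util U t h g"
      using M0_util[OF h(1) f(2,1)] c le M0_odot[OF h o f(2)] by simp
    then show "util U t (fst p) (snd p) \<le> util U t (fst q) (snd q)"
      using odot_util_eq[OF assms(3) t h o f(2)] by (simp add: pq)
  qed blast
  have G_le: "G (h, c, v) \<le> G (h', c, v')"
    if "h \<in> hists T cbar t" "h' \<in> hists T cbar t" "odot T cbar P U t h h'" "c \<in> {0..cbar}" "v \<le> v'"
    for h h' c v v'
    using G_mono[of "(h, c, v)" "(h', c, v')"] \<tau>0[of "(h, c, v)" "(h', c, v')"] that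
    by (simp add: hists_def)

  have "stage_aggregators T cbar P U t (\<lambda>h c v. G (h, c, v)) M"
    unfolding stage_aggregators_def
  proof (intro conjI ballI allI impI)
    show "continuous_map ?Y euclideanreal (\<lambda>(h, c, v). G (h, c, v))"
      using G_cont by (simp add: case_prod_unfold)
    show "mono (\<lambda>v. G (h, c, v))" if "h \<in> hists T cbar t" "c \<in> {0..cbar}" for h c
      using G_le[OF that(1,1) odot_self[OF that(1)] that(2)] by (intro monoI)
    show "G (h, c, v) = G (h', c, v)"
      if "h \<in> hists T cbar t" "h' \<in> hists T cbar t" "odot T cbar P U t h h'" "c \<in> {0..cbar}" for h h' c v
      using G_le[OF that] G_le[OF that(2,1) odot_sym[OF that(3)] that(4)] by (intro antisym) auto
    show "continuous_map (prod_topology ?H euclidean) euclideanreal (\<lambda>(h, u). M h u)"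
      unfolding M_def case_prod_unfold prod.collapse
      by (intro continuous_map_real_max continuous_map_real_min F_cont
          continuous_map_compose[OF continuous_map_snd continuous_map_Max_range, unfolded o_def]
          continuous_map_compose[OF continuous_map_snd continuous_map_Min_range, unfolded o_def])
    show "mono (M h)" if "h \<in> hists T cbar t" for h
      unfolding M_def
      by (intro monoI max.mono min.mono Max_range_mono Min_range_mono F_le[OF that that odot_self[OF that]])
    show "M h (\<lambda>_. v) = v" for h v
      by (simp add: M_def)
    show "M h = M h'"
      if "h \<in> hists T cbar t" "h' \<in> hists T cbar t" "odot T cbar P U t h h'" for h h'
    proof -
      have "F (h, u) = F (h', u)" for u
        using F_le[OF that] F_le[OF that(2,1) odot_sym[OF that(3)]] by (intro antisym) auto
      then show ?thesis by (simp add: M_def)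
    qed
    show "util U t h f = G (h, p_con f, M h (?u h f))"
      if "h \<in> hists T cbar t" "f \<in> plans T cbar t" for h f
      using G_ext[of "(h, f)"] that M_ext[OF that] by (simp add: topspace_dec_top decs_def)
  qed
  then show ?thesis by blast
qed

text \<open>Backward induction on \<open>T - t\<close>. Since the step map commutes with projection,
  the induction hypothesis identifies the generated continuation utilities with
  \<open>tilde_u\<close>, and the one-stage identity \<open>WM\<close> closes the step. At
  \<open>t = T\<close> compatibility matches the terminal value.\<close>

lemma gen_util_canonical:
  fixes P :: "('s::finite) grand_pref" and U :: "'s util_sys"
  assumes "compatible T cbar P U" "weak_order T cbar P"
    and V: "\<And>h. h \<in> hists T cbar (Suc T) \<Longrightarrow> pa_V V (canon_proj T cbar P U (Suc T) h) = uterm U h"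
    and WM: "\<And>t h f. t < T \<Longrightarrow> h \<in> hists T cbar t \<Longrightarrow> f \<in> plans T cbar t \<Longrightarrow>
      util U t h f = pa_W V t (canon_proj T cbar P U t h) (p_con f)
        (pa_M V t (canon_proj T cbar P U t h) (tilde_u T U t h f))"
    and "t \<le> T" "h \<in> hists T cbar t" "f \<in> plans T cbar t"
  shows "gen_util T (canonical_sys T cbar P U) V t (canon_proj T cbar P U t h) f = util U t h f"
  using assms(5-)
proof (induction "T - t" arbitrary: t h f)
  case 0
  then have [simp]: "t = T" by simp
  obtain c where f: "f = term_plan c" and c: "c \<in> {0..cbar}"
    using 0 by (auto simp: plans_terminal)
  have s: "(Star :: 's pstate) \<in> states T (Suc T)" by (simp add: states_def)
  have "gen_util T (canonical_sys T cbar P U) V t (canon_proj T cbar P U t h) f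
      = uterm U (iota T T h c Star)"
    using 0 c s by (simp add: f term_plan_def canon_step_proj[OF assms(2)] V iota_in_hists)
  also have "\<dots> = util U t h f"
    using assms(1) 0 c by (simp add: f compatible_def)
  finally show ?case .
next
  case (Suc n)
  from Suc.hyps(2) have t: "t < T" "n = T - Suc t" by simp_all
  obtain c fp where f: "f = Plan c fp" and c: "c \<in> {0..cbar}" and fp: "\<And>s. fp s \<in> plans T cbar (Suc t)"
    using t(1) Suc.prems by (auto simp: plans_Plan conts_def)
  have "gen_util T (canonical_sys T cbar P U) V (Suc t)
      (pa_step (canonical_sys T cbar P U) t (canon_proj T cbar P U t h) c (Phys s)) (fp s)
      = tilde_u T U t h f s" for s
    using t c fp Suc.prems(2) Suc.hyps(1)[OF t(2), of "iota T t h c (Phys s)" "fp s"]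
    by (simp add: canon_step_proj[OF assms(2)] Phys_in_states iota_in_hists tilde_u_def f)
  then show ?case
    using WM[OF t(1) Suc.prems(2,3)] t(1) by (simp add: f)
qed

theorem theorem4p12:
  fixes T :: nat and cbar :: real
    and P :: "('s::finite) grand_pref" and U :: "'s util_sys"
  assumes "T \<ge> 1" and "cbar \<ge> 0"
    and "grand_preference T cbar P"
    and "utility_system T cbar U" and "compatible T cbar P U"
    and "weak_order T cbar P"
    and "pref_continuity T cbar P"
    and "dynamic_consistency T cbar P"
    and "terminal_compatibility T cbar P"
    and "compensated_monotonicity T cbar P"
    and "weak_separability T cbar P"
    and "ce_richness T cbar P U"
  shows "\<exists>V. pa_recursive_structure T cbar (canonical_sys T cbar P U) V \<and>
             factorizes T cbar (canonical_sys T cbar P U) V U \<and>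
             represents T cbar (canonical_sys T cbar P U) V P"
proof -
  let ?X = "canonical_sys T cbar P U"
  let ?\<sigma> = "canon_proj T cbar P U"
  let ?r = "\<lambda>x :: 's hist set. SOME h. h \<in> x"
  note wo = assms(6)
  obtain W M where WM: "\<And>t. t < T \<Longrightarrow> stage_aggregators T cbar P U t (W t) (M t)"
    using stage_aggregators_exist[OF assms(2,4,5,12)] by metis
  \<comment> \<open>The aggregators on classes evaluate those on histories at a chosen
    representative; invariance under \<open>odot\<close> makes the choice immaterial, as
    \<open>W_r\<close>, \<open>M_r\<close> and \<open>V_r\<close> record.\<close>
  define V where "V = \<lparr>pa_W = (\<lambda>t x. W t (?r x)), pa_M = (\<lambda>t x. M t (?r x)), pa_V = (\<lambda>x. uterm U (?r x))\<rparr>"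
  have V_sel: "pa_W V t x = W t (?r x)" "pa_M V t x = M t (?r x)" "pa_V V x = uterm U (?r x)" for t x
    by (simp_all add: V_def)
  have r: "?r (?\<sigma> t h) \<in> hists T cbar t" "odot T cbar P U t h (?r (?\<sigma> t h))"
    if "t \<le> Suc T" "h \<in> hists T cbar t" for t h
    using canon_rep[OF wo that] by auto
  have W_r: "pa_W V t (?\<sigma> t h) c v = W t h c v"
    if "t < T" "h \<in> hists T cbar t" "c \<in> {0..cbar}" for t h c v
  proof -
    have "W t h c v = W t (?r (?\<sigma> t h)) c v"
      using WM[OF that(1)] r[OF _ that(2)] that unfolding stage_aggregators_def by (meson less_imp_le le_SucI)
    then show ?thesis unfolding V_sel ..
  qed
  have M_r: "pa_M V t (?\<sigma> t h) u = M t h u" if "t < T" "h \<in> hists T cbar t" for t h u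
  proof -
    have "M t h = M t (?r (?\<sigma> t h))"
      using WM[OF that(1)] r[OF _ that(2)] that unfolding stage_aggregators_def by (meson less_imp_le le_SucI)
    then show ?thesis unfolding V_sel by simp
  qed
  have V_r: "pa_V V (?\<sigma> (Suc T) h) = uterm U h" if "h \<in> hists T cbar (Suc T)" for h
    unfolding V_sel using r(2)[of "Suc T" h] that by (simp add: odot_final)
  have "pa_recursive_structure T cbar ?X V"
    unfolding pa_recursive_structure_def
  proof (intro conjI allI impI ballI)
    show "pa_state_system T cbar ?X"
      by (rule pa_state_system_canonical[OF assms(2,4,5) wo])
    show "continuous_map (pa_top ?X (Suc T)) euclideanreal (pa_V V)"
    proof (rule continuous_compose_quotient_map[OF quotient_map_canon_proj])
      have "continuous_map (hist_top T cbar (Suc T)) euclideanreal (uterm U)"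
        using assms(4) unfolding utility_system_def by blast
      then show "continuous_map (hist_top T cbar (Suc T)) euclideanreal (pa_V V \<circ> ?\<sigma> (Suc T))"
        by (rule continuous_map_eq) (simp add: V_r hists_def del: hist_top.simps)
    qed
  next
    fix t assume t: "t < T"
    note WMt = WM[OF t, unfolded stage_aggregators_def]
    show "continuous_map (prod_topology (pa_top ?X t) (prod_topology (C_top cbar) euclideanreal))
        euclideanreal (\<lambda>(x, c, v). pa_W V t x c v)"
    \<comment> \<open>The first clause of \<open>stage_aggregators\<close> is continuity of
      \<open>W\<close> on histories; it descends because the space of consumption and value is
      locally compact and Hausdorff.\<close>
    proof (rule continuous_map_from_quotient_prod[OF quotient_map_canon_proj _ _ conjunct1[OF WMt]])
      show "locally_compact_space (prod_topology (C_top cbar) euclideanreal)"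
        by (simp add: locally_compact_space_prod_topology locally_compact_space_euclidean
            compact_imp_locally_compact_space compact_space_C_top)
      show "Hausdorff_space (prod_topology (C_top cbar) euclideanreal)"
        by (simp add: Hausdorff_space_prod_topology Hausdorff_space_subtopology)
    qed (use W_r[OF t] in \<open>auto simp flip: hists_def\<close>)
    have "continuous_map (prod_topology (hist_top T cbar t) euclidean) euclideanreal (\<lambda>(h, u). M t h u)"
      using WMt by blast
    then show "continuous_map (prod_topology (pa_top ?X t) euclidean) euclideanreal
        (\<lambda>(x, u). pa_M V t x u)"
      by (rule continuous_map_from_quotient_prod[OF quotient_map_canon_proj
            locally_compact_space_fun Hausdorff_space_fun])
        (use M_r[OF t] in \<open>auto simp flip: hists_def\<close>)
    fix x assume "x \<in> topspace (pa_top ?X t)"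
    then have rx: "?r x \<in> hists T cbar t"
      using r(1)[of t] t by (auto simp: topspace_canonical)
    show "mono (pa_W V t x c)" if "c \<in> {0..cbar}" for c
      unfolding V_sel using WMt rx that by blast
    show "mono (pa_M V t x)"
      unfolding V_sel using WMt rx by blast
    show "pa_M V t x (\<lambda>_. v) = v" for v
      unfolding V_sel using WMt by blast
  qed
  moreover have fac: "factorizes T cbar ?X V U"
    unfolding factorizes_def
  proof (intro exI[of _ ?\<sigma>] conjI allI impI ballI)
    show "continuous_map (hist_top T cbar t) (pa_top ?X t) (?\<sigma> t)" for t
      by (intro quotient_imp_continuous_map quotient_map_canon_proj)
    show "pa_st ?X t (?\<sigma> t h) = phys_state h" if "t \<le> Suc T" "h \<in> hists T cbar t" for t h
      by (rule canon_st_proj[OF wo that])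
    show "uterm U h = gen_util T ?X V (Suc T) (?\<sigma> (Suc T) h) PEnd" if "h \<in> hists T cbar (Suc T)" for h
      using V_r[OF that] by simp
    show "?\<sigma> (Suc t) (iota T t h c s) = pa_step ?X t (?\<sigma> t h) c s"
      if "t \<le> T" "h \<in> hists T cbar t" "c \<in> {0..cbar}" "s \<in> states T (Suc t)" for t h c s
      using canon_step_proj[OF wo that] by simp
    show "util U t h f = gen_util T ?X V t (?\<sigma> t h) f"
      if "t \<le> T" "h \<in> hists T cbar t" "f \<in> plans T cbar t" for t h f
    proof (rule gen_util_canonical[OF assms(5) wo V_r _ that, symmetric])
      fix t and h :: "'s hist" and f :: "'s plan"
      assume t: "t < T" and h: "h \<in> hists T cbar t" and f: "f \<in> plans T cbar t"
      have "util U t h f = W t h (p_con f) (M t h (tilde_u T U t h f))"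
        using WM[OF t] h f unfolding stage_aggregators_def by blast
      then show "util U t h f = pa_W V t (?\<sigma> t h) (p_con f) (pa_M V t (?\<sigma> t h) (tilde_u T U t h f))"
        using W_r[OF t h plans_sel(1)[OF _ f]] M_r[OF t h] t by simp
    qed
  qed
  moreover have "represents T cbar ?X V P"
    \<comment> \<open>The compatible utility system required here is \<open>U\<close>
      itself.\<close>
    unfolding represents_def using assms(4,5) fac by blast
  ultimately show ?thesis by blast
qed

end
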